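(* Let $\Omega$ be a $\sigma$-compact metric space, $\nu$ a probability measure on the Borel $\sigma$-field of $\Omega$, $\mathcal{C}\in\mathbb{R}^{m\times m\times p}$ a symmetric T-product tensor, and $\tau\mapsto\mathcal{D}_\tau\in\mathbb{R}^{m\times m\times p}$ a continuous map from $\Omega$ into symmetric T-product tensors with $\sup_{\tau\in\Omega}\|\mathcal{D}_\tau\|<\infty$. Then the following are equivalent: (i) $\vec{\lambda}(\mathcal{C})\prec\int_{\Omega}\vec{\lambda}(\mathcal{D}_\tau)\,d\nu(\tau)$; (ii) for every convex function $f:\mathbb{R}\to[0,\infty)$ and every unitarily invariant norm $\|\cdot\|_\rho$, $$\|f(\mathcal{C})\|_\rho\le\int_\Omega\|f(\mathcal{D}_\tau)\|_\rho\,d\nu(\tau).$$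
   Context: T-product basics: for $\mathcal{C}\in\mathbb{C}^{m\times n\times p}$ with frontal slices $C^{(1)},\dots,C^{(p)}$, $\mathrm{bcirc}(\mathcal{C})$ is the $mp\times np$ block-circulant matrix with $(i,j)$ block $C^{(((i-j)\bmod p)+1)}$, $\mathrm{unfold}(\mathcal{C})$ stacks the slices vertically, $\mathrm{fold}=\mathrm{unfold}^{-1}$, and $\mathcal{C}\star\mathcal{D}=\mathrm{fold}(\mathrm{bcirc}(\mathcal{C})\mathrm{unfold}(\mathcal{D}))$. $\mathcal{C}^H=\mathrm{bcirc}^{-1}(\mathrm{bcirc}(\mathcal{C})^H)$, $\mathcal{C}^T=\mathrm{bcirc}^{-1}(\mathrm{bcirc}(\mathcal{C})^T)$; a real square tensor is symmetric if $\mathcal{C}^T=\mathcal{C}$. The identity $\mathcal{I}=\mathrm{bcirc}^{-1}(I_{mp})$. Every square $\mathcal{C}$ satisfies $\mathrm{bcirc}(\mathcal{C})=(F_p^H\otimes I_m)\mathrm{Diag}(C_1,\dots,C_p)(F_p\otimes I_m)$ with $F_p$ the normalized $p\times p$ DFT matrix; $C_1,\dots,C_p$ are the Fourier blocks (Hermitian if $\mathcal{C}$ is symmetric). The T-eigenvalues of a symmetric $\mathcal{C}$ are the $mp$ eigenvalues (with multiplicity) of $C_1,\dots,C_p$, listed as $\lambda_1(\mathcal{C})\ge\dots\ge\lambda_{mp}(\mathcal{C})$, and $\vec\lambda(\mathcal{C})=(\lambda_1(\mathcal{C}),\dots,\lambda_{mp}(\mathcal{C}))$; the T-singular values $\sigma_1(\mathcal{C})\ge\dots\ge\sigma_{mp}(\mathcal{C})$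 are the singular values of $C_1,\dots,C_p$ together. For a function $f$ on the T-eigenvalues, $f(\mathcal{C})$ is the tensor with $\mathrm{bcirc}(f(\mathcal{C}))=(F_p^H\otimes I_m)\mathrm{Diag}(f(C_1),\dots,f(C_p))(F_p\otimes I_m)$. $|\mathcal{H}|=(\mathcal{H}^H\star\mathcal{H})^{1/2}$. Unitarily invariant norms: for a symmetric gauge function $\rho$ on $\mathbb{R}^{mp}_{\ge 0}$ (restriction of a permutation-invariant absolute norm), $\|\mathcal{H}\|_\rho=\rho(\vec\lambda(|\mathcal{H}|))=\rho(\sigma_1(\mathcal{H}),\dots,\sigma_{mp}(\mathcal{H}))$; $\|\cdot\|$ denotes the operator norm $\sigma_1(\cdot)$. Majorization: for $x,y\in\mathbb{R}^r$ with decreasing rearrangements $x^\downarrow,y^\downarrow$, $x\prec y$ means $\sum_{i=1}^k x^\downarrow_i\le\sum_{i=1}^k y^\downarrow_i$ for all $k=1,\dots,r-1$ and $\sum_{i=1}^r x_i=\sum_{i=1}^r y_i$. The vector $\int_\Omega\vec{\lambda}(\mathcal{D}_\tau)\,d\nu(\tau)$ means $\big(\int_\Omega\lambda_1(\mathcal{D}_\tau)d\nu,\dots,\int_\Omega\lambda_{mp}(\mathcal{D}_\tau)d\nu\big)$. *)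

theory Defs
  imports "HOL-Probability.Probability" "Jordan_Normal_Form.Matrix" "Jordan_Normal_Form.Char_Poly"
begin

text \<open>Third-order tensors with entries indexed (i,j,k): row i, column j, frontal slice k,
  all indices 0-based (i < m, j < n, k < p).  Entries outside the range are irrelevant.\<close>

type_synonym rtensor = "nat \<Rightarrow> nat \<Rightarrow> nat \<Rightarrow> real"
type_synonym ctensor = "nat \<Rightarrow> nat \<Rightarrow> nat \<Rightarrow> complex"

definition ctensor_of :: "rtensor \<Rightarrow> ctensor" where
  "ctensor_of C = (\<lambda>i j k. complex_of_real (C i j k))"

definition bcirc :: "nat \<Rightarrow> nat \<Rightarrow> nat \<Rightarrow> ctensor \<Rightarrow> complex mat" where
  "bcirc m n p C = mat (m*p) (n*p)
     (\<lambda>(r,c). C (r mod m) (c mod n) (nat ((int (r div m) - int (c div n)) mod int p)))"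

definition bcirc_inv :: "nat \<Rightarrow> complex mat \<Rightarrow> ctensor" where
  "bcirc_inv m M = (\<lambda>i j k. M $$ (k*m + i, j))"

definition adj :: "complex mat \<Rightarrow> complex mat" where
  "adj A = mat (dim_col A) (dim_row A) (\<lambda>(i,j). cnj (A $$ (j,i)))"

definition unitary :: "complex mat \<Rightarrow> bool" where
  "unitary U \<longleftrightarrow> dim_row U = dim_col U \<and> U * adj U = 1\<^sub>m (dim_row U) \<and> adj U * U = 1\<^sub>m (dim_row U)"

definition DFT :: "nat \<Rightarrow> complex mat" where
  "DFT p = mat p p (\<lambda>(j,k). cis (- 2 * pi * real j * real k / real p) / complex_of_real (sqrt (real p)))"

definition kron :: "complex mat \<Rightarrow> complex mat \<Rightarrow> complex mat" where
  "kron A B = mat (dim_row A * dim_row B) (dim_col A * dim_col B)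
     (\<lambda>(r,c). A $$ (r div dim_row B, c div dim_col B) * B $$ (r mod dim_row B, c mod dim_col B))"

definition block_diag :: "nat \<Rightarrow> nat \<Rightarrow> (nat \<Rightarrow> complex mat) \<Rightarrow> complex mat" where
  "block_diag m p B = mat (m*p) (m*p)
     (\<lambda>(r,c). if r div m = c div m then B (r div m) $$ (r mod m, c mod m) else 0)"

text \<open>Fourier blocks C_1..C_p (here indexed 0..p-1): the diagonal blocks of
  (F_p \<otimes> I_m) bcirc(C) (F_p^H \<otimes> I_m), so that
  bcirc(C) = (F_p^H \<otimes> I_m) Diag(C_1,...,C_p) (F_p \<otimes> I_m).\<close>
definition fourier_block :: "nat \<Rightarrow> nat \<Rightarrow> ctensor \<Rightarrow> nat \<Rightarrow> complex mat" where
  "fourier_block m p C k =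
     (let M = kron (DFT p) (1\<^sub>m m) * bcirc m m p C * kron (adj (DFT p)) (1\<^sub>m m)
      in mat m m (\<lambda>(i,j). M $$ (k*m + i, k*m + j)))"

definition ttranspose :: "nat \<Rightarrow> nat \<Rightarrow> nat \<Rightarrow> ctensor \<Rightarrow> ctensor" where
  "ttranspose m n p C = bcirc_inv n (transpose_mat (bcirc m n p C))"

definition tsymmetric :: "nat \<Rightarrow> nat \<Rightarrow> rtensor \<Rightarrow> bool" where
  "tsymmetric m p C \<longleftrightarrow>
     (\<forall>i<m. \<forall>j<m. \<forall>k<p. ttranspose m m p (ctensor_of C) i j k = ctensor_of C i j k)"

definition eigvals_mset :: "complex mat \<Rightarrow> complex multiset" where
  "eigvals_mset A = proots (char_poly A)"

definition sorted_desc :: "real multiset \<Rightarrow> real list" where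
  "sorted_desc M = rev (sorted_list_of_multiset M)"

text \<open>T-eigenvalue vector lambda(C) of a symmetric real tensor: the mp eigenvalues of all
  Fourier blocks (Hermitian, hence real), listed decreasingly.  Entry i is lambda_{i+1}.\<close>
definition t_eigvals :: "nat \<Rightarrow> nat \<Rightarrow> rtensor \<Rightarrow> real list" where
  "t_eigvals m p C = sorted_desc
     (\<Sum>k<p. image_mset Re (eigvals_mset (fourier_block m p (ctensor_of C) k)))"

definition t_singvals :: "nat \<Rightarrow> nat \<Rightarrow> ctensor \<Rightarrow> real list" where
  "t_singvals m p H = sorted_desc
     (\<Sum>k<p. image_mset (\<lambda>z. sqrt (Re z))
        (eigvals_mset (adj (fourier_block m p H k) * fourier_block m p H k)))"

definition t_opnorm :: "nat \<Rightarrow> nat \<Rightarrow> rtensor \<Rightarrow> real" where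
  "t_opnorm m p C = hd (t_singvals m p (ctensor_of C))"

definition rdiag :: "nat \<Rightarrow> (nat \<Rightarrow> real) \<Rightarrow> complex mat" where
  "rdiag n d = mat n n (\<lambda>(i,j). if i = j then complex_of_real (d i) else 0)"

definition mat_fun :: "(real \<Rightarrow> real) \<Rightarrow> complex mat \<Rightarrow> complex mat" where
  "mat_fun f A = (SOME B. \<exists>U d. U \<in> carrier_mat (dim_row A) (dim_row A) \<and> unitary U \<and>
      A = U * rdiag (dim_row A) d * adj U \<and> B = U * rdiag (dim_row A) (f \<circ> d) * adj U)"

definition tensor_fun :: "nat \<Rightarrow> nat \<Rightarrow> (real \<Rightarrow> real) \<Rightarrow> rtensor \<Rightarrow> ctensor" where
  "tensor_fun m p f C = bcirc_inv m
     (kron (adj (DFT p)) (1\<^sub>m m)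
       * block_diag m p (\<lambda>k. mat_fun f (fourier_block m p (ctensor_of C) k))
       * kron (DFT p) (1\<^sub>m m))"

text \<open>Symmetric gauge functions on R^N, vectors as lists of length N: permutation-invariant
  absolute norms (the gauge function is their restriction to the nonnegative orthant).\<close>
definition sym_gauge :: "nat \<Rightarrow> (real list \<Rightarrow> real) \<Rightarrow> bool" where
  "sym_gauge N \<rho> \<longleftrightarrow>
     (\<forall>x. length x = N \<longrightarrow> 0 \<le> \<rho> x \<and> (\<rho> x = 0 \<longleftrightarrow> (\<forall>i<N. x ! i = 0))) \<and>
     (\<forall>x c. length x = N \<longrightarrow> \<rho> (map ((*) c) x) = \<bar>c\<bar> * \<rho> x) \<and>
     (\<forall>x y. length x = N \<longrightarrow> length y = N \<longrightarrow> \<rho> (map2 (+) x y) \<le> \<rho> x + \<rho> y) \<and>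
     (\<forall>x. length x = N \<longrightarrow> \<rho> (map abs x) = \<rho> x) \<and>
     (\<forall>x \<pi>. length x = N \<longrightarrow> \<pi> permutes {..<N} \<longrightarrow> \<rho> (map (\<lambda>i. x ! \<pi> i) [0..<N]) = \<rho> x)"

definition ui_norm :: "nat \<Rightarrow> nat \<Rightarrow> (real list \<Rightarrow> real) \<Rightarrow> ctensor \<Rightarrow> real" where
  "ui_norm m p \<rho> H = \<rho> (t_singvals m p H)"

definition majorized :: "real list \<Rightarrow> real list \<Rightarrow> bool" where
  "majorized x y \<longleftrightarrow> length x = length y \<and>
     (let xs = rev (sort x); ys = rev (sort y) in
       (\<forall>k\<in>{1..<length x}. (\<Sum>i<k. xs ! i) \<le> (\<Sum>i<k. ys ! i)) \<and>
       (\<Sum>i<length x. x ! i) = (\<Sum>i<length y. y ! i))"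

end

theory Submission
  imports Defs "Jordan_Normal_Form.Schur_Decomposition"
begin

text \<open>
  Every norm in (ii) is \<open>\<rho>(f(\<lambda>))\<close> for the vector \<open>\<lambda>\<close> of T-eigenvalues, and \<open>\<Phi> = \<rho> \<circ> f\<close> is convex and
  permutation invariant.  For (i) implies (ii), take a subgradient \<open>c\<close> of \<open>\<Phi>\<close> at \<open>\<lambda>(C)\<close> and
  permute \<open>\<lambda>(D \<tau>)\<close> so that it is ordered like \<open>c\<close>; this does not change \<open>\<Phi>\<close>, and integrating the
  subgradient inequality leaves a linear term that Abel summation bounds below by 0 because of
  majorization.  For (ii) implies (i), test with functions \<open>f\<close> that are affine on a common bound of
  all spectra and with Ky Fan norms, which then give the partial sums of the eigenvalues.
\<close>

text \<open>Jensen's inequality alone does not give (ii), because \<lambda>(C) is only majorized by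
  the mean of the spectra and need not be that mean. The subgradient closes this gap without doubly
  stochastic matrices, and it supplies an integrable affine minorant of the norm. The right side of
  (ii) is a nonnegative integral, monotone in arbitrary integrands and possibly infinite, so
  bounding its integrand from below by the positive part of that minorant is enough.

  In the converse the test functions have to be nonnegative on the whole line, hence the form max(0,
  a t + B) with B bounding all spectra. The value a = 1 yields the partial sums; a = -1, used only
  for the full sum, yields the reverse inequality between the totals and so their equality.

  The integrals in (i) call for measurable ordered eigenvalues. Instead of perturbation bounds, the
  proof uses that traces of powers of the Fourier blocks are polynomials in the tensor
  entries.\<close>

section \<open>Convex symmetric functions and majorization\<close>

text \<open>
  The extension step of Hahn--Banach, one coordinate at a time: the new slope separates the slopes
  of \<open>\<Phi>\<close> to the left of \<open>x n\<close> from those to the right.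
\<close>

lemma convex_subgradient_coordinates:
  fixes \<Phi> :: "(nat \<Rightarrow> real) \<Rightarrow> real"
  assumes conv: "\<And>u v t. 0 \<le> t \<Longrightarrow> t \<le> 1 \<Longrightarrow>
      \<Phi> (\<lambda>i. (1 - t) * u i + t * v i) \<le> (1 - t) * \<Phi> u + t * \<Phi> v"
  shows "\<exists>c. \<forall>v. (\<forall>i\<ge>n. v i = x i) \<longrightarrow> \<Phi> x + (\<Sum>i<n. c i * (v i - x i)) \<le> \<Phi> v"
proof (induction n)
  case 0
  have "v = x" if "\<forall>i\<ge>0. v i = x i" for v :: "nat \<Rightarrow> real"
    using that by auto
  then show ?case by auto
next
  case (Suc n)
  then obtain c where c: "\<And>v. (\<forall>i\<ge>n. v i = x i) \<Longrightarrow> \<Phi> x + (\<Sum>i<n. c i * (v i - x i)) \<le> \<Phi> v"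
    by blast
  define L where "L v = \<Phi> x + (\<Sum>i<n. c i * (v i - x i))" for v :: "nat \<Rightarrow> real"
  define P where "P v \<longleftrightarrow> (\<forall>i\<ge>Suc n. v i = x i)" for v :: "nat \<Rightarrow> real"
  define Q where "Q = (\<lambda>u. (L u - \<Phi> u) / (x n - u n)) ` {u. P u \<and> u n < x n}"
  have slopes: "(L u - \<Phi> u) / (x n - u n) \<le> (\<Phi> w - L w) / (w n - x n)"
    if u: "P u" "u n < x n" and w: "P w" "x n < w n" for u w
  proof -
    \<comment> \<open>The weight \<open>t\<close> is chosen so that the convex combination of
      \<open>u\<close> and \<open>w\<close> has \<open>n\<close>-th coordinate exactly
      \<open>x n\<close>. It then agrees with \<open>x\<close> from \<open>n\<close> on, and the
      induction hypothesis applies to it.\<close>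
    define s r t where "s = x n - u n" and "r = w n - x n" and "t = s / (s + r)"
    have sr: "s > 0" "r > 0" using u w by (auto simp: s_def r_def)
    have t: "0 \<le> t" "t \<le> 1" using sr by (auto simp: t_def field_simps)
    have t1: "1 - t = r / (s + r)" using sr by (simp add: t_def field_simps)
    define v where "v = (\<lambda>i. (1 - t) * u i + t * w i)"
    have "v i = x i" if "i \<ge> n" for i
    proof (cases "i = n")
      case True
      have un: "u n = x n - s" and wn: "w n = x n + r"
        by (auto simp: s_def r_def)
      have "v n = (r * (x n - s) + s * (x n + r)) / (s + r)"
        unfolding v_def t1 by (simp add: t_def un wn add_divide_distrib)
      also have "\<dots> = x n * (s + r) / (s + r)" by (simp add: algebra_simps)
      finally show ?thesis using True sr by simp
    next
      case False
      then have "u i = x i" "w i = x i" using that u w by (auto simp: P_def)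
      then show ?thesis by (simp add: v_def algebra_simps)
    qed
    then have "L v \<le> \<Phi> v" using c[of v] by (auto simp: L_def)
    also have "\<Phi> v \<le> (1 - t) * \<Phi> u + t * \<Phi> w"
      unfolding v_def by (rule conv[OF t])
    also have "L v = (1 - t) * L u + t * L w"
      unfolding L_def v_def
      by (simp add: algebra_simps sum.distrib sum_distrib_left sum_subtractf)
    finally have "(1 - t) * (L u - \<Phi> u) \<le> t * (\<Phi> w - L w)"
      by (simp add: algebra_simps)
    then have "r * (L u - \<Phi> u) / (s + r) \<le> s * (\<Phi> w - L w) / (s + r)"
      unfolding t1 by (simp add: t_def)
    then have "r * (L u - \<Phi> u) \<le> s * (\<Phi> w - L w)"
      using sr by (simp add: divide_le_cancel)
    then show ?thesis using sr by (simp add: s_def[symmetric] r_def[symmetric] field_simps)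
  qed
  have "Q \<noteq> {}"
  proof -
    have "x(n := x n - 1) \<in> {u. P u \<and> u n < x n}" by (simp add: P_def)
    then show ?thesis unfolding Q_def by blast
  qed
  have "bdd_above Q"
  proof (rule bdd_aboveI)
    fix q assume "q \<in> Q"
    then obtain u where "P u" "u n < x n" "q = (L u - \<Phi> u) / (x n - u n)"
      unfolding Q_def by blast
    then show "q \<le> (\<Phi> (x(n := x n + 1)) - L (x(n := x n + 1))) / ((x(n := x n + 1)) n - x n)"
      using slopes[of u "x(n := x n + 1)"] by (simp add: P_def)
  qed
  define a where "a = Sup Q"
  have main: "\<Phi> x + (\<Sum>i<Suc n. (c(n := a)) i * (v i - x i)) \<le> \<Phi> v"
    if v: "\<forall>i\<ge>Suc n. v i = x i" for v
  proof -
    have eq: "\<Phi> x + (\<Sum>i<Suc n. (c(n := a)) i * (v i - x i)) = L v + a * (v n - x n)"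
      by (simp add: L_def)
    consider "v n = x n" | "v n < x n" | "x n < v n" by linarith
    then have "L v + a * (v n - x n) \<le> \<Phi> v"
    proof cases
      case 1
      have "\<forall>i\<ge>n. v i = x i"
      proof (intro allI impI)
        fix i assume "n \<le> i"
        then show "v i = x i" using v 1 by (cases "i = n") auto
      qed
      then show ?thesis using c[of v] 1 by (simp add: L_def)
    next
      case 2
      then have "(L v - \<Phi> v) / (x n - v n) \<le> a"
        unfolding a_def using v \<open>bdd_above Q\<close> by (intro cSup_upper) (auto simp: Q_def P_def)
      then show ?thesis using 2 by (simp add: field_simps)
    next
      case 3
      have "a \<le> (\<Phi> v - L v) / (v n - x n)"
        unfolding a_def using 3 v slopes by (intro cSup_least[OF \<open>Q \<noteq> {}\<close>]) (auto simp: Q_def P_def)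
      then show ?thesis using 3 by (simp add: field_simps)
    qed
    then show ?thesis unfolding eq .
  qed
  show ?case
  proof (rule exI[of _ "c(n := a)"], intro allI impI)
    fix v assume "\<forall>i\<ge>Suc n. v i = x i"
    then show "\<Phi> x + (\<Sum>i<Suc n. (c(n := a)) i * (v i - x i)) \<le> \<Phi> v" by (rule main)
  qed
qed

text \<open>Abel summation. The coefficients may be negative: replacing \<open>a k\<close> by the
  smaller \<open>a (Suc k)\<close> only decreases its product with a nonnegative partial sum, and
  the last coefficient multiplies the total, which is 0.\<close>

lemma sum_antimono_mult_nonneg:
  fixes a w :: "nat \<Rightarrow> real"
  assumes "\<And>i j. i \<le> j \<Longrightarrow> j < n \<Longrightarrow> a j \<le> a i"
    and "\<And>k. k \<le> n \<Longrightarrow> 0 \<le> (\<Sum>i<k. w i)"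
    and "(\<Sum>i<n. w i) = 0"
  shows "0 \<le> (\<Sum>i<n. a i * w i)"
proof (cases n)
  case (Suc m)
  \<comment> \<open>The induction carries the boundary term of Abel summation on the left; at
    \<open>k = m\<close> it vanishes by the hypothesis on the total.\<close>
  have "k \<le> m \<Longrightarrow> a k * (\<Sum>i<Suc k. w i) \<le> (\<Sum>i<Suc k. a i * w i)" for k
  proof (induction k)
    case (Suc k)
    have "a (Suc k) * (\<Sum>i<Suc k. w i) \<le> a k * (\<Sum>i<Suc k. w i)"
      using Suc.prems assms(1)[of k "Suc k"] assms(2)[of "Suc k"] \<open>n = Suc m\<close>
      by (intro mult_right_mono) auto
    also have "\<dots> \<le> (\<Sum>i<Suc k. a i * w i)" using Suc by simp
    finally show ?case by (simp add: algebra_simps)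
  qed simp
  from this[of m] show ?thesis using assms(3) Suc by simp
qed simp

text \<open>Exchange argument: as many elements of \<open>S\<close> lie outside the first
  \<open>k\<close> indices as initial indices are missing from \<open>S\<close>, and the value at
  index \<open>k - 1\<close> separates the two groups.\<close>

lemma sum_le_sum_initial:
  fixes x :: "nat \<Rightarrow> real"
  assumes dec: "\<And>i j. i \<le> j \<Longrightarrow> j < n \<Longrightarrow> x j \<le> x i"
    and S: "S \<subseteq> {..<n}" "card S = k"
  shows "sum x S \<le> (\<Sum>i<k. x i)"
proof (cases k)
  case 0
  then have "S = {}" using S finite_subset[OF S(1)] by auto
  then show ?thesis using 0 by simp
next
  case (Suc l)
  have fin: "finite S" using S(1) finite_subset by blast
  have kn: "k \<le> n" using S card_mono[of "{..<n}" S] by auto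
  define T where "T = {..<k}"
  have "card S = card (S \<inter> T) + card (S - T)" "card T = card (T \<inter> S) + card (T - S)"
    using card_Int_Diff[of S T] card_Int_Diff[of T S] fin by (auto simp only: T_def finite_lessThan)
  then have card_eq: "card (S - T) = card (T - S)"
    using S(2) by (simp add: Int_commute T_def)
  have "sum x (S - T) \<le> of_nat (card (S - T)) * x l"
    using S Suc by (intro sum_bounded_above dec) (auto simp: T_def)
  also have "\<dots> \<le> sum x (T - S)"
    unfolding card_eq using kn Suc by (intro sum_bounded_below dec) (auto simp: T_def)
  finally have "sum x (S - T) + sum x (S \<inter> T) \<le> sum x (T - S) + sum x (S \<inter> T)" by simp
  moreover have "sum x (S - T) + sum x (S \<inter> T) = sum x S"
    using sum.Int_Diff[OF fin, of x T] by simp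
  moreover have "sum x (T - S) + sum x (S \<inter> T) = sum x T"
    using sum.Int_Diff[of T x S] by (simp add: T_def Int_commute)
  ultimately show ?thesis by (simp add: T_def)
qed

lemma ex_permutes_antimono:
  fixes c :: "nat \<Rightarrow> real"
  shows "\<exists>\<pi>. \<pi> permutes {..<n} \<and> (\<forall>i j. i \<le> j \<longrightarrow> j < n \<longrightarrow> c (\<pi> j) \<le> c (\<pi> i))"
proof -
  define l where "l = sort_key (\<lambda>i. - c i) [0..<n]"
  have l: "length l = n" "set l = {..<n}" "distinct l"
    by (auto simp: l_def)
  have srt: "sorted (map (\<lambda>i. - c i) l)" by (simp only: l_def sorted_sort_key)
  define \<pi> where "\<pi> = (\<lambda>i. if i < n then l ! i else i)"
  have "bij_betw ((!) l) {..<n} {..<n}"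
    by (rule bij_betw_nth) (simp_all only: l)
  then have "bij_betw \<pi> {..<n} {..<n}"
    by (rule bij_betw_cong[THEN iffD1, rotated]) (simp add: \<pi>_def)
  then have "\<pi> permutes {..<n}"
    by (intro bij_imp_permutes) (auto simp: \<pi>_def)
  moreover have "c (\<pi> j) \<le> c (\<pi> i)" if "i \<le> j" "j < n" for i j
    using sorted_nth_mono[OF srt, of i j] that l by (simp add: \<pi>_def)
  ultimately show ?thesis by blast
qed

text \<open>This is the analytic core of (i) to (ii), for an abstract convex symmetric function.
  Vectors are functions on all naturals, of which \<open>cong\<close> makes only the first
  \<open>n\<close> coordinates count.\<close>

lemma (in prob_space) symmetric_convex_le_nn_integral:
  fixes \<Phi> :: "(nat \<Rightarrow> real) \<Rightarrow> real" and y :: "'a \<Rightarrow> nat \<Rightarrow> real"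
  assumes conv: "\<And>u v t. 0 \<le> t \<Longrightarrow> t \<le> 1 \<Longrightarrow>
      \<Phi> (\<lambda>i. (1 - t) * u i + t * v i) \<le> (1 - t) * \<Phi> u + t * \<Phi> v"
    and cong: "\<And>u v. (\<And>i. i < n \<Longrightarrow> u i = v i) \<Longrightarrow> \<Phi> u = \<Phi> v"
    and perm: "\<And>\<pi> v. \<pi> permutes {..<n} \<Longrightarrow> \<Phi> (\<lambda>i. v (\<pi> i)) = \<Phi> v"
    and dec: "\<And>i j. i \<le> j \<Longrightarrow> j < n \<Longrightarrow> x j \<le> x i"
    and int: "\<And>i. i < n \<Longrightarrow> integrable M (\<lambda>\<omega>. y \<omega> i)"
    and major: "\<And>k. k \<le> n \<Longrightarrow> (\<Sum>i<k. x i) \<le> (\<Sum>i<k. \<integral>\<omega>. y \<omega> i \<partial>M)"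
    and total: "(\<Sum>i<n. x i) = (\<Sum>i<n. \<integral>\<omega>. y \<omega> i \<partial>M)"
  shows "ennreal (\<Phi> x) \<le> (\<integral>\<^sup>+\<omega>. ennreal (\<Phi> (y \<omega>)) \<partial>M)"
proof -
  obtain c where c: "\<And>v. (\<forall>i\<ge>n. v i = x i) \<Longrightarrow> \<Phi> x + (\<Sum>i<n. c i * (v i - x i)) \<le> \<Phi> v"
    using convex_subgradient_coordinates[where \<Phi> = \<Phi> and n = n and x = x] conv by blast
  obtain \<pi> where \<pi>: "\<pi> permutes {..<n}" and \<pi>_dec: "\<And>i j. i \<le> j \<Longrightarrow> j < n \<Longrightarrow> c (\<pi> j) \<le> c (\<pi> i)"
    using ex_permutes_antimono[of n c] by blast
  \<comment> \<open>Affine in \<open>y\<close>, hence integrable, whatever the integrability of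
    \<open>\<Phi>\<close> along \<open>y\<close>.\<close>
  define g where "g \<omega> = \<Phi> x + (\<Sum>i<n. c (\<pi> i) * (y \<omega> i - x (\<pi> i)))" for \<omega>
  have lower: "g \<omega> \<le> \<Phi> (y \<omega>)" for \<omega>
  proof -
    \<comment> \<open>\<open>v\<close> carries coordinate \<open>i\<close> of \<open>y\<close> to
      position \<open>\<pi> i\<close>, so the largest coordinates meet the largest entries of
      \<open>c\<close>. Beyond \<open>n\<close> it has to coincide with \<open>x\<close> for the
      subgradient inequality.\<close>
    define v where "v = (\<lambda>i. if i < n then y \<omega> (inv_into UNIV \<pi> i) else x i)"
    have \<pi>n: "\<pi> i < n" if "i < n" for i
      using permutes_in_image[OF \<pi>, of i] that by simp
    have v\<pi>: "v (\<pi> i) = y \<omega> i" if "i < n" for i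
      using \<pi>n[OF that] permutes_inverses(2)[OF \<pi>] by (simp add: v_def)
    have "g \<omega> = \<Phi> x + (\<Sum>i<n. c (\<pi> i) * (v (\<pi> i) - x (\<pi> i)))"
      by (simp add: g_def v\<pi>)
    also have "(\<Sum>i<n. c (\<pi> i) * (v (\<pi> i) - x (\<pi> i))) = (\<Sum>i<n. c i * (v i - x i))"
      using sum.permute[OF \<pi>, of "\<lambda>i. c i * (v i - x i)"] by (simp add: o_def)
    also have "\<Phi> x + \<dots> \<le> \<Phi> v" by (rule c) (auto simp: v_def)
    also have "\<Phi> v = \<Phi> (\<lambda>i. v (\<pi> i))" using perm[OF \<pi>, of v] by simp
    also have "\<dots> = \<Phi> (y \<omega>)" by (rule cong) (rule v\<pi>)
    finally show ?thesis .
  qed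
  have int_g: "integrable M g"
    unfolding g_def using int by (intro Bochner_Integration.integrable_add Bochner_Integration.integrable_sum
        integrable_mult_right Bochner_Integration.integrable_diff integrable_const) auto
  have "(\<integral>\<omega>. g \<omega> \<partial>M) = \<Phi> x + (\<Sum>i<n. c (\<pi> i) * ((\<integral>\<omega>. y \<omega> i \<partial>M) - x (\<pi> i)))"
  proof -
    have "(\<integral>\<omega>. g \<omega> \<partial>M) = (\<integral>\<omega>. \<Phi> x \<partial>M) + (\<integral>\<omega>. (\<Sum>i<n. c (\<pi> i) * (y \<omega> i - x (\<pi> i))) \<partial>M)"
      unfolding g_def using int by (intro Bochner_Integration.integral_add integrable_const
          Bochner_Integration.integrable_sum integrable_mult_right Bochner_Integration.integrable_diff) auto
    also have "(\<integral>\<omega>. (\<Sum>i<n. c (\<pi> i) * (y \<omega> i - x (\<pi> i))) \<partial>M)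
        = (\<Sum>i<n. \<integral>\<omega>. c (\<pi> i) * (y \<omega> i - x (\<pi> i)) \<partial>M)"
      using int by (intro Bochner_Integration.integral_sum integrable_mult_right
          Bochner_Integration.integrable_diff integrable_const) auto
    also have "\<dots> = (\<Sum>i<n. c (\<pi> i) * ((\<integral>\<omega>. y \<omega> i \<partial>M) - x (\<pi> i)))"
      using int by (intro sum.cong refl) (simp add: prob_space)
    finally show ?thesis by (simp add: prob_space)
  qed
  moreover have "0 \<le> (\<Sum>i<n. c (\<pi> i) * ((\<integral>\<omega>. y \<omega> i \<partial>M) - x (\<pi> i)))"
  proof (rule sum_antimono_mult_nonneg)
    show "c (\<pi> j) \<le> c (\<pi> i)" if "i \<le> j" "j < n" for i j using \<pi>_dec that .
    \<comment> \<open>Composed with \<open>\<pi>\<close>, \<open>x\<close> may lose its order, but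
      then its partial sums can only drop below those of the decreasing \<open>x\<close>, so the
      majorization inequalities survive.\<close>
    show "0 \<le> (\<Sum>i<k. (\<integral>\<omega>. y \<omega> i \<partial>M) - x (\<pi> i))" if "k \<le> n" for k
    proof -
      have inj: "inj_on \<pi> {..<k}" using \<pi> permutes_inj inj_on_subset by blast
      have "(\<Sum>i<k. x (\<pi> i)) = sum x (\<pi> ` {..<k})"
        using sum.reindex[OF inj, of x] by (simp only: o_def)
      also have "\<dots> \<le> (\<Sum>i<k. x i)"
      proof (rule sum_le_sum_initial[where n = n])
        have "\<pi> ` {..<k} \<subseteq> \<pi> ` {..<n}" using that by (intro image_mono) simp
        then show "\<pi> ` {..<k} \<subseteq> {..<n}" using permutes_image[OF \<pi>] by simp
      qed (simp_all only: dec card_image[OF inj] card_lessThan)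
      finally show ?thesis using major[OF that] by (simp add: sum_subtractf)
    qed
    show "(\<Sum>i<n. (\<integral>\<omega>. y \<omega> i \<partial>M) - x (\<pi> i)) = 0"
      using sum.permute[OF \<pi>, of x] total by (simp add: sum_subtractf o_def)
  qed
  ultimately have "\<Phi> x \<le> (\<integral>\<omega>. g \<omega> \<partial>M)" by simp
  \<comment> \<open>Cutting off at 0 is what allows the passage to the nonnegative integral;
    \<open>ennreal\<close> sends negative values to 0, so the cut-off function is still a
    minorant.\<close>
  also have "\<dots> \<le> (\<integral>\<omega>. max 0 (g \<omega>) \<partial>M)"
    using int_g by (intro integral_mono) auto
  finally have "ennreal (\<Phi> x) \<le> ennreal (\<integral>\<omega>. max 0 (g \<omega>) \<partial>M)"
    by (rule ennreal_leI)
  also have "\<dots> = (\<integral>\<^sup>+\<omega>. ennreal (max 0 (g \<omega>)) \<partial>M)"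
    using int_g by (intro nn_integral_eq_integral[symmetric]) auto
  also have "\<dots> \<le> (\<integral>\<^sup>+\<omega>. ennreal (\<Phi> (y \<omega>)) \<partial>M)"
    using lower by (intro nn_integral_mono) (auto simp: max_def ennreal_leI)
  finally show ?thesis .
qed

section \<open>Symmetric gauge functions\<close>

lemma sym_gauge_scale: "sym_gauge n \<rho> \<Longrightarrow> length x = n \<Longrightarrow> \<rho> (map ((*) c) x) = \<bar>c\<bar> * \<rho> x"
  unfolding sym_gauge_def by blast

lemma sym_gauge_add:
  "sym_gauge n \<rho> \<Longrightarrow> length x = n \<Longrightarrow> length y = n \<Longrightarrow> \<rho> (map2 (+) x y) \<le> \<rho> x + \<rho> y"
  unfolding sym_gauge_def by blast

lemma sym_gauge_abs: "sym_gauge n \<rho> \<Longrightarrow> length x = n \<Longrightarrow> \<rho> (map abs x) = \<rho> x"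
  unfolding sym_gauge_def by blast

lemma sym_gauge_permute:
  "sym_gauge n \<rho> \<Longrightarrow> length x = n \<Longrightarrow> \<pi> permutes {..<n} \<Longrightarrow>
     \<rho> (map (\<lambda>i. x ! \<pi> i) [0..<n]) = \<rho> x"
  unfolding sym_gauge_def by blast

text \<open>Spectra are obtained below as multisets; this makes the order in which they are listed
  irrelevant to the norm.\<close>

lemma sym_gauge_mset_cong:
  assumes "sym_gauge n \<rho>" "length y = n" "mset x = mset y"
  shows "\<rho> x = \<rho> y"
proof -
  obtain \<pi> where "\<pi> permutes {..<length y}" "permute_list \<pi> y = x"
    using mset_eq_permutation[OF assms(3)] by blast
  then show ?thesis
    using sym_gauge_permute[OF assms(1,2), of \<pi>] assms(2) by (auto simp: permute_list_def)
qed

lemma sym_gauge_convex: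
  fixes u v :: "nat \<Rightarrow> real"
  assumes g: "sym_gauge n \<rho>" and ab: "0 \<le> a" "0 \<le> b"
  shows "\<rho> (map (\<lambda>i. a * u i + b * v i) [0..<n])
      \<le> a * \<rho> (map u [0..<n]) + b * \<rho> (map v [0..<n])"
proof -
  have "map (\<lambda>i. a * u i + b * v i) [0..<n]
      = map2 (+) (map ((*) a) (map u [0..<n])) (map ((*) b) (map v [0..<n]))"
    by (simp only: map_map map2_map_map o_def)
  then show ?thesis
    using sym_gauge_add[OF g, of "map ((*) a) (map u [0..<n])" "map ((*) b) (map v [0..<n])"]
      sym_gauge_scale[OF g, of "map u [0..<n]" a] sym_gauge_scale[OF g, of "map v [0..<n]" b] ab
    by simp
qed

text \<open>Convexity of \<open>f\<close> only bounds the entries of a vector from above, so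
  composing \<open>\<rho>\<close> with \<open>f\<close> is convex only once \<open>\<rho>\<close> is
  known to respect the entrywise order on nonnegative vectors.\<close>

lemma sym_gauge_mono:
  fixes u w :: "nat \<Rightarrow> real"
  assumes g: "sym_gauge n \<rho>" and uw: "\<And>i. i < n \<Longrightarrow> 0 \<le> u i" "\<And>i. i < n \<Longrightarrow> u i \<le> w i"
  shows "\<rho> (map u [0..<n]) \<le> \<rho> (map w [0..<n])"
proof -
  \<comment> \<open>Shrinking one coordinate is averaging a vector with its reflection in that coordinate.\<close>
  have shrink: "\<rho> (map (v(j := s * v j)) [0..<n]) \<le> \<rho> (map v [0..<n])"
    if s: "0 \<le> s" "s \<le> 1" for v :: "nat \<Rightarrow> real" and j s
  proof -
    define v' where "v' = v(j := - v j)"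
    have "map abs (map v' [0..<n]) = map abs (map v [0..<n])" by (simp add: v'_def)
    then have "\<rho> (map v' [0..<n]) = \<rho> (map v [0..<n])"
      using sym_gauge_abs[OF g, of "map v' [0..<n]"] sym_gauge_abs[OF g, of "map v [0..<n]"]
      by (metis length_map length_upt minus_nat.diff_0)
    moreover have "v(j := s * v j) = (\<lambda>i. (1 + s) / 2 * v i + (1 - s) / 2 * v' i)"
      by (rule ext) (simp add: v'_def field_simps)
    ultimately show ?thesis
      using sym_gauge_convex[OF g, of "(1 + s) / 2" "(1 - s) / 2" v v'] s by (simp add: field_simps)
  qed
  \<comment> \<open>Hybrid vectors lead from \<open>w\<close> to \<open>u\<close> by changing one
    coordinate at a time.\<close>
  define h where "h k = (\<lambda>i. if i < k then u i else w i)" for k :: nat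
  have "k \<le> n \<Longrightarrow> \<rho> (map (h k) [0..<n]) \<le> \<rho> (map w [0..<n])" for k
  proof (induction k)
    case 0
    then show ?case by (simp add: h_def)
  next
    case (Suc k)
    \<comment> \<open>If \<open>w k = 0\<close> then \<open>u k = 0\<close> too, and division by
      zero gives \<open>s = 0\<close>, so \<open>s * w k = u k\<close> holds in every case.\<close>
    define s where "s = u k / w k"
    have k: "0 \<le> u k" "u k \<le> w k" using uw Suc.prems by auto
    have s: "0 \<le> s" "s \<le> 1" "s * w k = u k"
      using k by (auto simp: s_def divide_le_eq_1)
    have "h (Suc k) = (h k)(k := s * h k k)"
      using s by (auto simp: h_def less_Suc_eq)
    then have "\<rho> (map (h (Suc k)) [0..<n]) \<le> \<rho> (map (h k) [0..<n])"
      using shrink[OF s(1,2), of "h k" k] by (simp only:)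
    then show ?case using Suc by simp
  qed
  from this[of n] have "\<rho> (map (h n) [0..<n]) \<le> \<rho> (map w [0..<n])" by simp
  moreover have "map (h n) [0..<n] = map u [0..<n]" by (simp add: h_def)
  ultimately show ?thesis by simp
qed

lemma (in prob_space) sym_gauge_convex_le_nn_integral:
  fixes y :: "'a \<Rightarrow> nat \<Rightarrow> real"
  assumes g: "sym_gauge n \<rho>" and f: "convex_on UNIV f" "\<And>x. 0 \<le> f x"
    and dec: "\<And>i j. i \<le> j \<Longrightarrow> j < n \<Longrightarrow> x j \<le> x i"
    and int: "\<And>i. i < n \<Longrightarrow> integrable M (\<lambda>\<omega>. y \<omega> i)"
    and major: "\<And>k. k \<le> n \<Longrightarrow> (\<Sum>i<k. x i) \<le> (\<Sum>i<k. \<integral>\<omega>. y \<omega> i \<partial>M)"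
    and total: "(\<Sum>i<n. x i) = (\<Sum>i<n. \<integral>\<omega>. y \<omega> i \<partial>M)"
  shows "ennreal (\<rho> (map (\<lambda>i. f (x i)) [0..<n]))
      \<le> (\<integral>\<^sup>+\<omega>. ennreal (\<rho> (map (\<lambda>i. f (y \<omega> i)) [0..<n])) \<partial>M)"
proof (rule symmetric_convex_le_nn_integral[where n = n and x = x and y = y
      and \<Phi> = "\<lambda>v. \<rho> (map (\<lambda>i. f (v i)) [0..<n])"])
  fix u v :: "nat \<Rightarrow> real" and t :: real
  assume t: "0 \<le> t" "t \<le> 1"
  have "\<rho> (map (\<lambda>i. f ((1 - t) * u i + t * v i)) [0..<n])
      \<le> \<rho> (map (\<lambda>i. (1 - t) * f (u i) + t * f (v i)) [0..<n])"
    using convex_onD[OF f(1), of t] t f(2) by (intro sym_gauge_mono[OF g]) auto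
  also have "\<dots> \<le> (1 - t) * \<rho> (map (\<lambda>i. f (u i)) [0..<n]) + t * \<rho> (map (\<lambda>i. f (v i)) [0..<n])"
    using sym_gauge_convex[OF g, of "1 - t" t "\<lambda>i. f (u i)" "\<lambda>i. f (v i)"] t by simp
  finally show "\<rho> (map (\<lambda>i. f ((1 - t) * u i + t * v i)) [0..<n])
      \<le> (1 - t) * \<rho> (map (\<lambda>i. f (u i)) [0..<n]) + t * \<rho> (map (\<lambda>i. f (v i)) [0..<n])" .
next
  fix u v :: "nat \<Rightarrow> real"
  assume "\<And>i. i < n \<Longrightarrow> u i = v i"
  then show "\<rho> (map (\<lambda>i. f (u i)) [0..<n]) = \<rho> (map (\<lambda>i. f (v i)) [0..<n])"
    by (intro arg_cong[of _ _ \<rho>] map_cong) auto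
next
  fix \<pi> :: "nat \<Rightarrow> nat" and v :: "nat \<Rightarrow> real"
  assume \<pi>: "\<pi> permutes {..<n}"
  have "map (\<lambda>i. f (v (\<pi> i))) [0..<n] = map (\<lambda>i. map (\<lambda>i. f (v i)) [0..<n] ! \<pi> i) [0..<n]"
    using permutes_in_image[OF \<pi>] by (intro map_cong) auto
  then show "\<rho> (map (\<lambda>i. f (v (\<pi> i))) [0..<n]) = \<rho> (map (\<lambda>i. f (v i)) [0..<n])"
    using sym_gauge_permute[OF g _ \<pi>, of "map (\<lambda>i. f (v i)) [0..<n]"]
    by (simp only: length_map length_upt minus_nat.diff_0)
qed (use assms in auto)

text \<open>The Ky Fan norm, usually described as the sum of the \<open>k\<close> largest absolute
  values. As a maximum over index sets it involves no sorting, and each norm axiom reduces to an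
  estimate for one fixed set.\<close>

definition ky_fan :: "nat \<Rightarrow> nat \<Rightarrow> real list \<Rightarrow> real" where
  "ky_fan n k x = Max ((\<lambda>S. \<Sum>i\<in>S. \<bar>x ! i\<bar>) ` {S. S \<subseteq> {..<n} \<and> card S = k})"

lemma ky_fan_le_iff:
  assumes "k \<le> n"
  shows "ky_fan n k x \<le> b \<longleftrightarrow> (\<forall>S. S \<subseteq> {..<n} \<longrightarrow> card S = k \<longrightarrow> (\<Sum>i\<in>S. \<bar>x ! i\<bar>) \<le> b)"
proof -
  have "finite {S. S \<subseteq> {..<n} \<and> card S = k}"
    by (rule finite_subset[of _ "Pow {..<n}"]) auto
  moreover have "{..<k} \<in> {S. S \<subseteq> {..<n} \<and> card S = k}" using assms by auto
  then have "{S. S \<subseteq> {..<n} \<and> card S = k} \<noteq> {}" by blast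
  ultimately show ?thesis unfolding ky_fan_def by (subst Max_le_iff) auto
qed

lemma ky_fan_upper:
  assumes "S \<subseteq> {..<n}" "card S = k"
  shows "(\<Sum>i\<in>S. \<bar>x ! i\<bar>) \<le> ky_fan n k x"
proof -
  have "k \<le> n" using assms card_mono[of "{..<n}" S] by auto
  from ky_fan_le_iff[OF this, of x "ky_fan n k x"] assms show ?thesis by auto
qed

lemma ky_fan_nonneg: "k \<le> n \<Longrightarrow> 0 \<le> ky_fan n k x"
  using ky_fan_upper[of "{..<k}" n k x] by (auto intro: order_trans[OF sum_nonneg])

text \<open>One inequality suffices here: the other one is this one applied to the inverse
  permutation. In the same way scaling by \<open>c\<close> is later undone by scaling with its
  inverse.\<close>

lemma ky_fan_permute_le:
  assumes "k \<le> n" and \<pi>: "\<pi> permutes {..<n}"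
  shows "ky_fan n k (map (\<lambda>i. x ! \<pi> i) [0..<n]) \<le> ky_fan n k x"
  unfolding ky_fan_le_iff[OF assms(1)]
proof (intro allI impI)
  fix S assume S: "S \<subseteq> {..<n}" "card S = k"
  have inj: "inj_on \<pi> S" using permutes_inj_on[OF \<pi>] .
  have "(\<Sum>i\<in>S. \<bar>map (\<lambda>i. x ! \<pi> i) [0..<n] ! i\<bar>) = (\<Sum>i\<in>S. \<bar>x ! \<pi> i\<bar>)"
    using S by (intro sum.cong) auto
  also have "\<dots> = (\<Sum>i\<in>\<pi> ` S. \<bar>x ! i\<bar>)" using sum.reindex[OF inj, of "\<lambda>i. \<bar>x ! i\<bar>"] by (simp only: o_def)
  also have "\<dots> \<le> ky_fan n k x"
  proof (rule ky_fan_upper)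
    show "\<pi> ` S \<subseteq> {..<n}" using image_mono[OF S(1), of \<pi>] permutes_image[OF \<pi>] by simp
    show "card (\<pi> ` S) = k" using S by (simp add: card_image[OF inj])
  qed
  finally show "(\<Sum>i\<in>S. \<bar>map (\<lambda>i. x ! \<pi> i) [0..<n] ! i\<bar>) \<le> ky_fan n k x" .
qed

lemma ky_fan_scale_le:
  assumes "k \<le> n" "length x = n"
  shows "ky_fan n k (map ((*) c) x) \<le> \<bar>c\<bar> * ky_fan n k x"
  unfolding ky_fan_le_iff[OF assms(1)]
proof (intro allI impI)
  fix S assume S: "S \<subseteq> {..<n}" "card S = k"
  have "(\<Sum>i\<in>S. \<bar>map ((*) c) x ! i\<bar>) = \<bar>c\<bar> * (\<Sum>i\<in>S. \<bar>x ! i\<bar>)"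
    unfolding sum_distrib_left using S assms by (intro sum.cong) (auto simp: abs_mult)
  then show "(\<Sum>i\<in>S. \<bar>map ((*) c) x ! i\<bar>) \<le> \<bar>c\<bar> * ky_fan n k x"
    using ky_fan_upper[OF S, of x] by (simp add: mult_left_mono)
qed

lemma sym_gauge_ky_fan:
  assumes k: "0 < k" "k \<le> n"
  shows "sym_gauge n (ky_fan n k)"
  unfolding sym_gauge_def
proof (intro conjI allI impI)
  fix x :: "real list" assume x: "length x = n"
  show "0 \<le> ky_fan n k x" by (rule ky_fan_nonneg[OF k(2)])
  show "(ky_fan n k x = 0) = (\<forall>i<n. x ! i = 0)"
  proof
    assume zero: "ky_fan n k x = 0"
    show "\<forall>i<n. x ! i = 0"
    proof (intro allI impI)
      fix i assume i: "i < n"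
      have "k - 1 \<le> card ({..<n} - {i})" using k i by simp
      \<comment> \<open>Since \<open>k\<close> is positive, the coordinate \<open>i\<close> can be
        completed to an index set of size \<open>k\<close>, on which the sum of absolute values
        dominates the \<open>i\<close>-th one.\<close>
      then obtain T where T: "T \<subseteq> {..<n} - {i}" "card T = k - 1" "finite T"
        by (rule obtain_subset_with_card_n)
      then have iT: "i \<notin> T" by auto
      have "(\<Sum>j\<in>insert i T. \<bar>x ! j\<bar>) \<le> ky_fan n k x"
        using T i k iT by (intro ky_fan_upper) auto
      then have "\<bar>x ! i\<bar> + (\<Sum>j\<in>T. \<bar>x ! j\<bar>) \<le> 0" using zero T iT by simp
      moreover have "0 \<le> (\<Sum>j\<in>T. \<bar>x ! j\<bar>)" by (intro sum_nonneg) auto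
      ultimately have "\<bar>x ! i\<bar> \<le> 0" by linarith
      then show "x ! i = 0" by simp
    qed
  next
    assume "\<forall>i<n. x ! i = 0"
    then have "(\<Sum>i\<in>S. \<bar>x ! i\<bar>) \<le> 0" if "S \<subseteq> {..<n}" for S
      using that by (intro sum_nonpos) auto
    then have "ky_fan n k x \<le> 0" by (simp add: ky_fan_le_iff[OF k(2)])
    then show "ky_fan n k x = 0" using ky_fan_nonneg[OF k(2), of x] by simp
  qed
next
  fix x :: "real list" and c :: real assume x: "length x = n"
  show "ky_fan n k (map ((*) c) x) = \<bar>c\<bar> * ky_fan n k x"
  proof (rule antisym)
    show "ky_fan n k (map ((*) c) x) \<le> \<bar>c\<bar> * ky_fan n k x"
      by (rule ky_fan_scale_le[OF k(2) x])
    show "\<bar>c\<bar> * ky_fan n k x \<le> ky_fan n k (map ((*) c) x)"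
    proof (cases "c = 0")
      case True
      then show ?thesis using ky_fan_nonneg[OF k(2)] by simp
    next
      case False
      have "map ((*) (inverse c)) (map ((*) c) x) = x"
        using False by (simp add: o_def mult.assoc[symmetric])
      then show ?thesis
        using ky_fan_scale_le[OF k(2), of "map ((*) c) x" "inverse c"] x False
        by (simp add: field_simps)
    qed
  qed
next
  fix x y :: "real list" assume xy: "length x = n" "length y = n"
  show "ky_fan n k (map2 (+) x y) \<le> ky_fan n k x + ky_fan n k y"
    unfolding ky_fan_le_iff[OF k(2)]
  proof (intro allI impI)
    fix S assume S: "S \<subseteq> {..<n}" "card S = k"
    have "(\<Sum>i\<in>S. \<bar>map2 (+) x y ! i\<bar>) \<le> (\<Sum>i\<in>S. \<bar>x ! i\<bar> + \<bar>y ! i\<bar>)"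
      using S xy by (intro sum_mono) (auto simp: subset_iff)
    also have "\<dots> = (\<Sum>i\<in>S. \<bar>x ! i\<bar>) + (\<Sum>i\<in>S. \<bar>y ! i\<bar>)" by (rule sum.distrib)
    also have "\<dots> \<le> ky_fan n k x + ky_fan n k y" by (intro add_mono ky_fan_upper S)
    finally show "(\<Sum>i\<in>S. \<bar>map2 (+) x y ! i\<bar>) \<le> ky_fan n k x + ky_fan n k y" .
  qed
next
  fix x :: "real list" assume x: "length x = n"
  have "(\<Sum>i\<in>S. \<bar>map abs x ! i\<bar>) = (\<Sum>i\<in>S. \<bar>x ! i\<bar>)" if "S \<subseteq> {..<n}" for S
    using that x by (intro sum.cong) auto
  then show "ky_fan n k (map abs x) = ky_fan n k x"
    unfolding ky_fan_def by (intro arg_cong[of _ _ Max] image_cong) auto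
next
  fix x :: "real list" and \<pi> assume x: "length x = n" and \<pi>: "\<pi> permutes {..<n}"
  show "ky_fan n k (map (\<lambda>i. x ! \<pi> i) [0..<n]) = ky_fan n k x"
  proof (rule antisym)
    show "ky_fan n k (map (\<lambda>i. x ! \<pi> i) [0..<n]) \<le> ky_fan n k x"
      by (rule ky_fan_permute_le[OF k(2) \<pi>])
    define \<sigma> where "\<sigma> = inv_into UNIV \<pi>"
    have \<sigma>: "\<sigma> permutes {..<n}" unfolding \<sigma>_def by (rule permutes_inv[OF \<pi>])
    have "\<sigma> i < n" if "i < n" for i using permutes_in_image[OF \<sigma>, of i] that by simp
    moreover have "\<pi> (\<sigma> i) = i" for i unfolding \<sigma>_def by (rule permutes_inverses(1)[OF \<pi>])
    ultimately have "map (\<lambda>i. map (\<lambda>i. x ! \<pi> i) [0..<n] ! \<sigma> i) [0..<n] = x"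
      using x by (intro nth_equalityI) auto
    then show "ky_fan n k x \<le> ky_fan n k (map (\<lambda>i. x ! \<pi> i) [0..<n])"
      using ky_fan_permute_le[OF k(2) \<sigma>, of "map (\<lambda>i. x ! \<pi> i) [0..<n]"] by simp
  qed
qed

lemma ky_fan_decreasing:
  fixes x :: "nat \<Rightarrow> real"
  assumes k: "k \<le> n" and dec: "\<And>i j. i \<le> j \<Longrightarrow> j < n \<Longrightarrow> x j \<le> x i"
    and nonneg: "\<And>i. i < n \<Longrightarrow> 0 \<le> x i"
  shows "ky_fan n k (map x [0..<n]) = (\<Sum>i<k. x i)"
proof -
  have eq: "(\<Sum>i\<in>S. \<bar>map x [0..<n] ! i\<bar>) = sum x S" if "S \<subseteq> {..<n}" for S
    using that nonneg by (intro sum.cong) auto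
  show ?thesis
  proof (rule antisym)
    show "ky_fan n k (map x [0..<n]) \<le> (\<Sum>i<k. x i)"
      unfolding ky_fan_le_iff[OF k] using sum_le_sum_initial[of n x, OF dec] eq by simp
    show "(\<Sum>i<k. x i) \<le> ky_fan n k (map x [0..<n])"
      using ky_fan_upper[of "{..<k}" n k "map x [0..<n]"] eq[of "{..<k}"] k by simp
  qed
qed

section \<open>Spectral theorem for Hermitian matrices\<close>

lemma adj_carrier [simp]: "A \<in> carrier_mat n m \<Longrightarrow> adj A \<in> carrier_mat m n"
  unfolding adj_def by (auto intro!: mat_carrier)

lemma adj_dim [simp]: "dim_row (adj A) = dim_col A" "dim_col (adj A) = dim_row A"
  by (simp_all add: adj_def)

lemma adj_index [simp]: "i < dim_col A \<Longrightarrow> j < dim_row A \<Longrightarrow> adj A $$ (i, j) = cnj (A $$ (j, i))"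
  by (simp add: adj_def)

lemma adj_adj [simp]: "adj (adj A) = A"
  by (rule eq_matI) simp_all

lemma mat_mult_index_sum:
  assumes "A \<in> carrier_mat n k" "B \<in> carrier_mat k m" "i < n" "j < m"
  shows "(A * B) $$ (i, j) = (\<Sum>l<k. A $$ (i, l) * B $$ (l, j))"
  using assms by (auto simp: scalar_prod_def atLeast0LessThan intro!: sum.cong)

lemma adj_mult:
  assumes A: "A \<in> carrier_mat n k" and B: "B \<in> carrier_mat k m"
  shows "adj (A * B) = adj B * adj A"
proof (rule eq_matI)
  fix i j assume "i < dim_row (adj B * adj A)" "j < dim_col (adj B * adj A)"
  then have ij: "i < m" "j < n" using A B by auto
  have "adj (A * B) $$ (i, j) = cnj ((A * B) $$ (j, i))" using ij A B by (intro adj_index) auto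
  also have "\<dots> = (\<Sum>l<k. cnj (A $$ (j, l)) * cnj (B $$ (l, i)))"
    unfolding mat_mult_index_sum[OF A B ij(2,1)] by simp
  also have "\<dots> = (\<Sum>l<k. adj B $$ (i, l) * adj A $$ (l, j))"
    using A B ij by (intro sum.cong refl) (simp add: mult.commute)
  also have "\<dots> = (adj B * adj A) $$ (i, j)"
    using mat_mult_index_sum[OF adj_carrier[OF B] adj_carrier[OF A] ij] by simp
  finally show "adj (A * B) $$ (i, j) = (adj B * adj A) $$ (i, j)" .
qed (use A B in auto)

lemma mult_carrier_square [simp]:
  "A \<in> carrier_mat n n \<Longrightarrow> B \<in> carrier_mat n n \<Longrightarrow> A * B \<in> carrier_mat n n"
  by (rule mult_carrier_mat)

lemma rdiag_carrier [simp]: "rdiag n d \<in> carrier_mat n n"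
  by (simp add: rdiag_def)

lemma adj_rdiag [simp]: "adj (rdiag n d) = rdiag n d"
  by (rule eq_matI) (auto simp: rdiag_def)

lemma rdiag_mult: "rdiag n a * rdiag n b = rdiag n (\<lambda>i. a i * b i)"
proof (rule eq_matI)
  fix i j assume "i < dim_row (rdiag n (\<lambda>i. a i * b i))" "j < dim_col (rdiag n (\<lambda>i. a i * b i))"
  then have ij: "i < n" "j < n" by (auto simp: rdiag_def)
  have "(rdiag n a * rdiag n b) $$ (i, j) = (\<Sum>l<n. if l = i then (if i = j then complex_of_real (a i * b i) else 0) else 0)"
    unfolding mat_mult_index_sum[OF rdiag_carrier rdiag_carrier ij]
    using ij by (intro sum.cong refl) (auto simp: rdiag_def)
  also have "\<dots> = rdiag n (\<lambda>i. a i * b i) $$ (i, j)" using ij by (simp add: rdiag_def)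
  finally show "(rdiag n a * rdiag n b) $$ (i, j) = rdiag n (\<lambda>i. a i * b i) $$ (i, j)" .
qed (simp_all add: rdiag_def)

lemma unitary_carrierD:
  assumes "unitary U" "U \<in> carrier_mat n n"
  shows "U * adj U = 1\<^sub>m n" "adj U * U = 1\<^sub>m n"
  using assms by (auto simp: unitary_def)

text \<open>For square matrices a left inverse is also a right inverse.\<close>

lemma unitaryI:
  assumes "U \<in> carrier_mat n n" "adj U * U = 1\<^sub>m n"
  shows "unitary U"
  using assms mat_mult_left_right_inverse[OF adj_carrier[OF assms(1)] assms(1,2)]
  by (auto simp: unitary_def)

lemma unitary_mult:
  assumes U: "U \<in> carrier_mat n n" "unitary U" and V: "V \<in> carrier_mat n n" "unitary V"
  shows "unitary (U * V)"
proof (rule unitaryI)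
  have "adj (U * V) * (U * V) = adj V * (adj U * U) * V"
    unfolding adj_mult[OF U(1) V(1)] using U V
    by (simp add: assoc_mult_mat[where ?n\<^sub>1 = n and ?n\<^sub>2 = n and ?n\<^sub>3 = n and ?n\<^sub>4 = n])
  also have "\<dots> = adj V * V" using unitary_carrierD[OF U(2,1)] V by simp
  also have "\<dots> = 1\<^sub>m n" using unitary_carrierD[OF V(2,1)] by simp
  finally show "adj (U * V) * (U * V) = 1\<^sub>m n" .
qed (use U V in auto)

lemma unitary_conj_mult:
  assumes U: "U \<in> carrier_mat n n" "unitary U" and A: "A \<in> carrier_mat n n" and B: "B \<in> carrier_mat n n"
  shows "(U * A * adj U) * (U * B * adj U) = U * (A * B) * adj U"
proof -
  have U': "adj U \<in> carrier_mat n n" using U by simp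
  have "(U * A * adj U) * (U * B * adj U) = U * A * (adj U * U) * B * adj U"
    using U U' A B by (simp add: assoc_mult_mat[where ?n\<^sub>1 = n and ?n\<^sub>2 = n and ?n\<^sub>3 = n and ?n\<^sub>4 = n])
  also have "\<dots> = U * A * B * adj U" using unitary_carrierD[OF U(2,1)] U A by simp
  also have "\<dots> = U * (A * B) * adj U"
    using U U' A B by (simp add: assoc_mult_mat[where ?n\<^sub>1 = n and ?n\<^sub>2 = n and ?n\<^sub>3 = n and ?n\<^sub>4 = n])
  finally show ?thesis .
qed

text \<open>Complete \<open>v\<close> to a basis, orthogonalize it with \<open>v\<close> in first
  place, and normalize the columns. The scalar \<open>\<alpha>\<close> is the normalizing factor of
  \<open>v\<close>.\<close>

lemma unitary_extension:
  fixes v :: "complex vec"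
  assumes v: "v \<in> carrier_vec n" and v0: "v \<noteq> 0\<^sub>v n"
  shows "\<exists>W \<alpha>. W \<in> carrier_mat n n \<and> unitary W \<and> col W 0 = \<alpha> \<cdot>\<^sub>v v"
proof -
  define b where "b = basis_completion v"
  define ws where "ws = gram_schmidt n b"
  interpret cof_vec_space n "TYPE(complex)" .
  have n: "n \<noteq> 0"
  proof
    assume "n = 0"
    then have "v = 0\<^sub>v n" using v by (intro eq_vecI) simp_all
    with v0 show False by simp
  qed
  from basis_completion[OF v v0, folded b_def]
  have b: "distinct b" "\<not> lin_dep (set b)" "set b \<subseteq> carrier_vec n" "hd b = v" "length b = n"
    by auto
  then obtain vs where bv: "b = v # vs" using n by (cases b) auto
  from gram_schmidt_result[OF b(3,1,2) refl, folded ws_def]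
  have ws: "set ws \<subseteq> carrier_vec n" "corthogonal ws" "length ws = n"
    by (auto simp: b)
  have hd: "hd ws = v" unfolding ws_def bv using v by simp
  have wsi: "ws ! i \<in> carrier_vec n" if "i < n" for i using ws that by auto
  have inner: "ws ! j \<bullet>c ws ! i = (\<Sum>l<n. ws ! j $ l * cnj (ws ! i $ l))" if "i < n" "j < n" for i j
    using wsi[OF that(1)] wsi[OF that(2)]
    by (auto simp: scalar_prod_def atLeast0LessThan intro!: sum.cong)
  \<comment> \<open>Squared lengths of the orthogonal vectors. \<open>corthogonal\<close> includes
    that no vector has zero inner product with itself, which makes them positive.\<close>
  define q where "q i = (\<Sum>l<n. (cmod (ws ! i $ l))\<^sup>2)" for i
  have q: "ws ! i \<bullet>c ws ! i = complex_of_real (q i)" if "i < n" for i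
    unfolding inner[OF that that] q_def by (simp add: complex_norm_square del: of_real_power)
  have q0: "q i > 0" if "i < n" for i
  proof -
    have "q i \<noteq> 0" using corthogonalD[OF ws(2), of i i] q[OF that] that ws(3) by auto
    moreover have "q i \<ge> 0" unfolding q_def by (intro sum_nonneg) auto
    ultimately show ?thesis by simp
  qed
  define W where "W = mat n n (\<lambda>(i, j). ws ! j $ i / complex_of_real (sqrt (q j)))"
  have W: "W \<in> carrier_mat n n" by (simp add: W_def)
  have "adj W * W = 1\<^sub>m n"
  proof (rule eq_matI)
    fix i j assume "i < dim_row (1\<^sub>m n :: complex mat)" "j < dim_col (1\<^sub>m n :: complex mat)"
    then have ij: "i < n" "j < n" by auto
    have "(adj W * W) $$ (i, j)
        = (\<Sum>l<n. (ws ! j $ l * cnj (ws ! i $ l)) / (complex_of_real (sqrt (q i)) * complex_of_real (sqrt (q j))))"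
      unfolding mat_mult_index_sum[OF adj_carrier[OF W] W ij]
      using ij W by (intro sum.cong refl) (simp add: W_def mult.commute)
    also have "\<dots> = (ws ! j \<bullet>c ws ! i) / (complex_of_real (sqrt (q i)) * complex_of_real (sqrt (q j)))"
      unfolding inner[OF ij] sum_divide_distrib ..
    also have "\<dots> = (1\<^sub>m n :: complex mat) $$ (i, j)"
    proof (cases "i = j")
      case True
      have "complex_of_real (sqrt (q i)) * complex_of_real (sqrt (q i)) = complex_of_real (q i)"
        using q0[OF ij(1)] by (simp flip: of_real_mult)
      then show ?thesis using True q0[OF ij(1)] q[OF ij(1)] ij by simp
    next
      case False
      then have "ws ! j \<bullet>c ws ! i = 0"
        using corthogonalD[OF ws(2), of j i] ij ws(3) by auto
      then show ?thesis using False ij by simp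
    qed
    finally show "(adj W * W) $$ (i, j) = (1\<^sub>m n :: complex mat) $$ (i, j)" .
  qed (use W in auto)
  then have "unitary W" by (rule unitaryI[OF W])
  moreover have "col W 0 = (1 / complex_of_real (sqrt (q 0))) \<cdot>\<^sub>v v"
  proof (rule eq_vecI)
    have "ws \<noteq> []" using ws(3) n by auto
    then have "ws ! 0 = v" using hd by (simp add: hd_conv_nth)
    then show "col W 0 $ i = ((1 / complex_of_real (sqrt (q 0))) \<cdot>\<^sub>v v) $ i"
      if "i < dim_vec ((1 / complex_of_real (sqrt (q 0))) \<cdot>\<^sub>v v)" for i
      using that v n by (simp add: W_def)
  qed (use W v in auto)
  ultimately show ?thesis using W by blast
qed

lemma eigenvector_exists:
  fixes A :: "complex mat"
  assumes A: "A \<in> carrier_mat n n" and n: "n \<noteq> 0"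
  shows "\<exists>v e. v \<in> carrier_vec n \<and> v \<noteq> 0\<^sub>v n \<and> A *\<^sub>v v = e \<cdot>\<^sub>v v"
proof -
  obtain as where as: "char_poly A = (\<Prod>a\<leftarrow>as. [:- a, 1:])" "length as = n"
    using char_poly_factorized[OF A] by blast
  then obtain e es where "as = e # es" using n by (cases as) auto
  then have "poly (char_poly A) e = 0" using as by simp
  then have "eigenvalue A e" using eigenvalue_root_char_poly[OF A] by simp
  then show ?thesis using A unfolding eigenvalue_def eigenvector_def by auto
qed

text \<open>Deflation: in an orthonormal basis that starts with an eigenvector, the first column of
  the matrix vanishes below the diagonal. The Hermitian property clears the first row as well and
  passes to the remaining block of size \<open>n\<close>, to which the induction hypothesis
  applies.\<close>

lemma hermitian_diagonalization:
  "A \<in> carrier_mat n n \<Longrightarrow> adj A = A \<Longrightarrow>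
     \<exists>U d. U \<in> carrier_mat n n \<and> unitary U \<and> A = U * rdiag n d * adj U"
proof (induction n arbitrary: A)
  case 0
  have "unitary (1\<^sub>m 0)"
  proof (rule unitaryI)
    show "adj (1\<^sub>m 0) * 1\<^sub>m 0 = 1\<^sub>m 0" by (rule eq_matI) simp_all
  qed simp
  moreover have "A = 1\<^sub>m 0 * rdiag 0 (\<lambda>_. 0) * adj (1\<^sub>m 0)"
    by (rule eq_matI) (use 0 in simp_all)
  ultimately show ?case using one_carrier_mat by blast
next
  case (Suc n)
  note A = Suc.prems
  let ?N = "Suc n"
  obtain v e where v: "v \<in> carrier_vec ?N" "v \<noteq> 0\<^sub>v ?N" "A *\<^sub>v v = e \<cdot>\<^sub>v v"
    using eigenvector_exists[OF A(1)] by auto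
  obtain W \<alpha> where W: "W \<in> carrier_mat ?N ?N" "unitary W" "col W 0 = \<alpha> \<cdot>\<^sub>v v"
    using unitary_extension[OF v(1,2)] by blast
  note assoc = assoc_mult_mat[where ?n\<^sub>1 = ?N and ?n\<^sub>2 = ?N and ?n\<^sub>3 = ?N and ?n\<^sub>4 = ?N]
  have W': "adj W \<in> carrier_mat ?N ?N" using W by simp
  define B where "B = adj W * (A * W)"
  have B: "B \<in> carrier_mat ?N ?N" using W A by (simp add: B_def)
  have herm: "adj B = B"
    unfolding B_def using adj_mult[OF W' mult_carrier_mat[OF A(1) W(1)]] adj_mult[OF A(1) W(1)] A W W'
    by (simp add: assoc)
  have col0: "B $$ (i, 0) = (if i = 0 then e else 0)" if "i < ?N" for i
  proof -
    have "(A * W) $$ (l, 0) = e * W $$ (l, 0)" if l: "l < ?N" for l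
    proof -
      have "(A * W) $$ (l, 0) = (A *\<^sub>v col W 0) $ l" using A W l by simp
      also have "A *\<^sub>v col W 0 = e \<cdot>\<^sub>v col W 0"
        unfolding W(3) using mult_mat_vec[OF A(1) v(1)] v by (simp add: smult_smult_assoc mult.commute)
      finally show ?thesis using W(1) l by simp
    qed
    then have "B $$ (i, 0) = (\<Sum>l<?N. e * (adj W $$ (i, l) * W $$ (l, 0)))"
      unfolding B_def using mat_mult_index_sum[OF W' mult_carrier_mat[OF A(1) W(1)] that, of 0]
      by (simp add: mult.left_commute del: sum.lessThan_Suc)
    also have "\<dots> = e * (adj W * W) $$ (i, 0)"
      using mat_mult_index_sum[OF W' W(1) that, of 0] by (simp only: sum_distrib_left zero_less_Suc)
    finally show ?thesis using unitary_carrierD[OF W(2,1)] that by simp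
  qed
  have B_cnj: "B $$ (i, j) = cnj (B $$ (j, i))" if "i < ?N" "j < ?N" for i j
  proof -
    have "adj B $$ (i, j) = cnj (B $$ (j, i))" by (rule adj_index) (use B that in auto)
    then show ?thesis unfolding herm .
  qed
  \<comment> \<open>The eigenvalue is a diagonal entry of the Hermitian matrix \<open>B\<close>,
    hence real, as an entry of \<open>rdiag\<close> has to be.\<close>
  have e: "e = complex_of_real (Re e)"
  proof -
    have "e = cnj e" using B_cnj[of 0 0] unfolding col0[OF zero_less_Suc] by simp
    then show ?thesis by (metis Reals_cnj_iff complex_is_Real_iff of_real_Re)
  qed
  have row0: "B $$ (0, j) = (if j = 0 then e else 0)" if "j < ?N" for j
  proof (cases "j = 0")
    case False
    then show ?thesis using B_cnj[OF zero_less_Suc that] unfolding col0[OF that] by simp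
  qed (use col0[OF zero_less_Suc] in simp)
  define A' where "A' = mat n n (\<lambda>(i, j). B $$ (Suc i, Suc j))"
  have A': "A' \<in> carrier_mat n n" "adj A' = A'"
    by (auto simp: A'_def B_cnj[symmetric] intro!: eq_matI)
  obtain U d where U: "U \<in> carrier_mat n n" "unitary U" "A' = U * rdiag n d * adj U"
    using Suc.IH[OF A'] by blast
  \<comment> \<open>The diagonalization of the small block is extended by a 1 in the corner, which
    leaves the eigenvector already split off in place.\<close>
  define V where "V = four_block_mat (1\<^sub>m 1) (0\<^sub>m 1 n) (0\<^sub>m n 1) U"
  define d' where "d' = case_nat (Re e) d"
  define E where "E = mat 1 1 (\<lambda>_. e)"
  have E: "E \<in> carrier_mat 1 1" by (simp add: E_def)
  have U': "adj U \<in> carrier_mat n n" using U by simp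
  have V: "V \<in> carrier_mat ?N ?N" using U by (auto simp: V_def)
  have adjV: "adj V = four_block_mat (1\<^sub>m 1) (0\<^sub>m 1 n) (0\<^sub>m n 1) (adj U)"
    using U by (intro eq_matI) (auto simp: V_def)
  have D: "rdiag ?N d' = four_block_mat E (0\<^sub>m 1 n) (0\<^sub>m n 1) (rdiag n d)"
    by (rule eq_matI) (auto simp: rdiag_def E_def d'_def e[symmetric] split: nat.splits)
  have "adj V * V = four_block_mat (1\<^sub>m 1) (0\<^sub>m 1 n) (0\<^sub>m n 1) (adj U * U)"
    unfolding adjV unfolding V_def using U U'
    by (subst mult_four_block_mat[where ?nr1.0 = 1 and ?n1.0 = 1 and ?n2.0 = n and ?nr2.0 = n and ?nc1.0 = 1 and ?nc2.0 = n]) auto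
  also have "\<dots> = 1\<^sub>m ?N" using unitary_carrierD[OF U(2,1)] by simp
  finally have uV: "unitary V" by (rule unitaryI[OF V])
  have "V * rdiag ?N d' = four_block_mat E (0\<^sub>m 1 n) (0\<^sub>m n 1) (U * rdiag n d)"
    unfolding D V_def using U E left_mult_zero_mat[OF rdiag_carrier, of 1 n d]
    by (subst mult_four_block_mat[where ?nr1.0 = 1 and ?n1.0 = 1 and ?n2.0 = n and ?nr2.0 = n and ?nc1.0 = 1 and ?nc2.0 = n]) auto
  then have "V * rdiag ?N d' * adj V = four_block_mat E (0\<^sub>m 1 n) (0\<^sub>m n 1) (U * rdiag n d * adj U)"
    unfolding adjV using U U' E right_mult_zero_mat[OF mult_carrier_square[OF U(1) rdiag_carrier], of d 1]
    by (simp, subst mult_four_block_mat[where ?nr1.0 = 1 and ?n1.0 = 1 and ?n2.0 = n and ?nr2.0 = n and ?nc1.0 = 1 and ?nc2.0 = n]) auto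
  also have "\<dots> = B"
    unfolding U(3)[symmetric]
  proof (rule eq_matI)
    fix i j assume "i < dim_row B" "j < dim_col B"
    then have ij: "i < ?N" "j < ?N" using B by auto
    show "four_block_mat E (0\<^sub>m 1 n) (0\<^sub>m n 1) A' $$ (i, j) = B $$ (i, j)"
    proof (cases "i = 0 \<or> j = 0")
      case True
      then show ?thesis using ij col0[OF ij(1)] row0[OF ij(2)] A'(1) by (auto simp: E_def)
    next
      case False
      then obtain k l where "i = Suc k" "j = Suc l" by (metis not0_implies_Suc)
      then show ?thesis using ij by (simp add: E_def A'_def)
    qed
  qed (use B A' in \<open>auto simp: E_def\<close>)
  finally have BV: "B = V * rdiag ?N d' * adj V" by simp
  have V': "adj V \<in> carrier_mat ?N ?N" using V by simp
  have "A = (W * adj W) * A * (W * adj W)" using unitary_carrierD[OF W(2,1)] A by simp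
  also have "\<dots> = W * B * adj W"
    unfolding B_def using A W W' by (simp add: assoc)
  also have "\<dots> = (W * V) * rdiag ?N d' * adj (W * V)"
    unfolding BV adj_mult[OF W(1) V] using W W' V V' by (simp add: assoc)
  finally have "A = (W * V) * rdiag ?N d' * adj (W * V)" .
  then show ?case
    using unitary_mult[OF W(1,2) V uV] mult_carrier_mat[OF W(1) V]
    by - (rule exI[of _ "W * V"], rule exI[of _ d'], rule conjI, assumption, rule conjI)
qed

section \<open>Eigenvalues, powers and trace of a unitarily diagonalized matrix\<close>

lemma eigvals_mset_unitary_conj:
  assumes "U \<in> carrier_mat n n" "unitary U"
  shows "eigvals_mset (U * rdiag n d * adj U) = mset (map (\<lambda>i. complex_of_real (d i)) [0..<n])"
proof -
  have "similar_mat (U * rdiag n d * adj U) (rdiag n d)"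
    using assms unitary_carrierD[OF assms(2,1)]
    by (intro similar_matI[where P = U and Q = "adj U" and n = n]) auto
  then have "char_poly (U * rdiag n d * adj U) = char_poly (rdiag n d)" by (rule char_poly_similar)
  also have "\<dots> = (\<Prod>a\<leftarrow>diag_mat (rdiag n d). [:- a, 1:])"
    by (rule char_poly_upper_triangular[OF rdiag_carrier]) (auto simp: rdiag_def)
  also have "diag_mat (rdiag n d) = map (\<lambda>i. complex_of_real (d i)) [0..<n]"
    by (auto simp: diag_mat_def rdiag_def intro!: nth_equalityI)
  finally have "eigvals_mset (U * rdiag n d * adj U)
      = proots (\<Prod>a\<leftarrow>map (\<lambda>i. complex_of_real (d i)) [0..<n]. [:- a, 1:])"
    by (simp add: eigvals_mset_def)
  also have "\<dots> = mset (map (\<lambda>i. complex_of_real (d i)) [0..<n])" 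
  proof -
    have "proots (\<Prod>a\<leftarrow>xs. [:- a, 1:]) = mset xs" for xs :: "complex list"
    proof (induction xs)
      case (Cons a xs)
      have "(\<Prod>a\<leftarrow>xs. [:- a, 1:]) \<noteq> 0" by (auto simp: prod_list_zero_iff)
      moreover have "[:- a, 1:] \<noteq> 0" by simp
      ultimately have "proots ([:- a, 1:] * (\<Prod>a\<leftarrow>xs. [:- a, 1:])) = {#a#} + mset xs"
        using Cons.IH by (subst proots_mult) auto
      then show ?case by simp
    qed simp
    then show ?thesis .
  qed
  finally show ?thesis .
qed

lemma pow_unitary_conj:
  assumes U: "U \<in> carrier_mat n n" "unitary U"
  shows "(U * rdiag n d * adj U) ^\<^sub>m k = U * rdiag n (\<lambda>i. d i ^ k) * adj U"
proof (induction k)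
  case 0
  have "rdiag n (\<lambda>i. 1) = 1\<^sub>m n" by (rule eq_matI) (auto simp: rdiag_def)
  then show ?case using unitary_carrierD[OF U(2,1)] U by simp
next
  case (Suc k)
  have "(U * rdiag n d * adj U) ^\<^sub>m Suc k
      = (U * rdiag n (\<lambda>i. d i ^ k) * adj U) * (U * rdiag n d * adj U)"
    by (simp only: pow_mat.simps Suc)
  also have "\<dots> = U * (rdiag n (\<lambda>i. d i ^ k) * rdiag n d) * adj U"
    by (rule unitary_conj_mult[OF U rdiag_carrier rdiag_carrier])
  finally show ?case by (simp only: rdiag_mult power_Suc2)
qed

text \<open>Invariance of the trace, by interchanging the two sums. Together with
  \<open>pow_unitary_conj\<close> it turns power sums of eigenvalues into traces of matrix
  powers.\<close>

lemma trace_unitary_conj: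
  assumes U: "U \<in> carrier_mat n n" "unitary U"
  shows "(\<Sum>i<n. (U * rdiag n d * adj U) $$ (i, i)) = complex_of_real (\<Sum>i<n. d i)"
proof -
  have UD: "(U * rdiag n d) $$ (i, j) = U $$ (i, j) * complex_of_real (d j)" if "i < n" "j < n" for i j
  proof -
    have "(U * rdiag n d) $$ (i, j) = (\<Sum>l<n. if l = j then U $$ (i, j) * complex_of_real (d j) else 0)"
      unfolding mat_mult_index_sum[OF U(1) rdiag_carrier that]
      using that by (intro sum.cong refl) (auto simp: rdiag_def)
    then show ?thesis using that by simp
  qed
  have "(\<Sum>i<n. (U * rdiag n d * adj U) $$ (i, i))
      = (\<Sum>i<n. \<Sum>l<n. complex_of_real (d l) * (adj U $$ (l, i) * U $$ (i, l)))"
  proof (intro sum.cong refl)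
    fix i assume "i \<in> {..<n}"
    then have i: "i < n" by simp
    show "(U * rdiag n d * adj U) $$ (i, i) = (\<Sum>l<n. complex_of_real (d l) * (adj U $$ (l, i) * U $$ (i, l)))"
      unfolding mat_mult_index_sum[OF mult_carrier_mat[OF U(1) rdiag_carrier] adj_carrier[OF U(1)] i i]
      using i UD by (intro sum.cong refl) simp
  qed
  also have "\<dots> = (\<Sum>l<n. \<Sum>i<n. complex_of_real (d l) * (adj U $$ (l, i) * U $$ (i, l)))"
    by (rule sum.swap)
  also have "\<dots> = (\<Sum>l<n. complex_of_real (d l) * (adj U * U) $$ (l, l))"
    using mat_mult_index_sum[OF adj_carrier[OF U(1)] U(1)] by (intro sum.cong refl) (simp add: sum_distrib_left)
  also have "\<dots> = complex_of_real (\<Sum>i<n. d i)"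
    using unitary_carrierD[OF U(2,1)] by simp
  finally show ?thesis .
qed

section \<open>Fourier blocks\<close>

text \<open>The \<open>n\<close>-th power of exp(-2 pi i / p). Integer exponents cover the entries
  of the DFT matrix and of its adjoint, as well as differences of block indices, in one
  notation.\<close>

definition root_of_one :: "nat \<Rightarrow> int \<Rightarrow> complex" where
  "root_of_one p n = cis (- 2 * pi * of_int n / real p)"

lemma root_of_one_add: "root_of_one p (a + b) = root_of_one p a * root_of_one p b"
  by (simp add: root_of_one_def cis_mult add_divide_distrib diff_divide_distrib algebra_simps)

lemma cnj_root_of_one: "cnj (root_of_one p a) = root_of_one p (- a)"
  by (simp add: root_of_one_def cis_cnj)

lemma root_of_one_mult_period:
  assumes "0 < p"
  shows "root_of_one p (int p * q) = 1"
proof -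
  have "- 2 * pi * of_int (int p * q) / real p = 2 * pi * of_int (- q)"
    using assms by simp
  then show ?thesis unfolding root_of_one_def by (simp only: cis_multiple_2pi Ints_of_int)
qed

lemma root_of_one_mod:
  assumes "0 < p"
  shows "root_of_one p (k * (n mod int p)) = root_of_one p (k * n)"
proof -
  have "k * n = k * (n mod int p) + int p * (k * (n div int p))"
    by (metis distrib_left mod_mult_div_eq mult.left_commute)
  then show ?thesis
    using root_of_one_add[of p "k * (n mod int p)" "int p * (k * (n div int p))"]
      root_of_one_mult_period[OF assms] by simp
qed

text \<open>Orthogonality of the characters of the cyclic group, as a geometric sum. The bound on
  \<open>n\<close> is the range of a difference of two block indices; within it only 0 is divisible
  by \<open>p\<close>.\<close>

lemma sum_root_of_one:
  assumes "0 < p" "\<bar>n\<bar> < int p"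
  shows "(\<Sum>l<p. root_of_one p (n * int l)) = (if n = 0 then of_nat p else 0)"
proof (cases "n = 0")
  case True
  then show ?thesis by (simp add: root_of_one_def)
next
  case False
  define z where "z = root_of_one p n"
  have pow: "root_of_one p (n * int l) = z ^ l" for l
  proof (induction l)
    case (Suc l)
    have "n * int (Suc l) = n * int l + n" by (simp add: algebra_simps)
    then show ?case using Suc by (simp add: root_of_one_add z_def mult.commute)
  qed (simp add: root_of_one_def)
  have "z ^ p = 1" using pow[of p] root_of_one_mult_period[OF assms(1), of n] by (simp add: mult.commute)
  moreover have "z \<noteq> 1"
  proof
    assume "z = 1"
    then have "cos (- 2 * pi * of_int n / real p) = 1"
      by (simp add: z_def root_of_one_def complex_eq_iff)
    then obtain m :: int where "- 2 * pi * of_int n / real p = of_int m * 2 * pi"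
      unfolding cos_one_2pi_int by blast
    then have "- 2 * pi * of_int n = of_int m * 2 * pi * real p"
      using assms(1) by (simp add: field_simps)
    then have "(2 * pi) * of_int (- n) = (2 * pi) * of_int (m * int p)"
      by (simp add: algebra_simps)
    then have "(of_int (- n) :: real) = of_int (m * int p)"
      unfolding mult_cancel_left by simp
    then have "- n = m * int p" by (simp only: of_int_eq_iff)
    then have "int p dvd n" by (metis dvd_minus_iff dvd_triv_right)
    then show False using False assms(2) zdvd_imp_le[of "int p" "\<bar>n\<bar>"] by auto
  qed
  ultimately have "(\<Sum>l<p. z ^ l) = 0" by (simp add: geometric_sum)
  then show ?thesis using False by (simp add: pow)
qed

text \<open>A periodic summand makes this a sum over the residues modulo \<open>p\<close>, which
  translation permutes. It absorbs the offset between row and column blocks of a circulant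
  matrix.\<close>

lemma sum_periodic_shift:
  fixes g :: "int \<Rightarrow> 'a::comm_monoid_add"
  assumes p: "0 < p" and g: "\<And>n. g (n mod int p) = g n"
  shows "(\<Sum>a<p. g (int a - b)) = (\<Sum>l<p. g (int l))"
proof (rule sum.reindex_bij_witness[where i = "\<lambda>l. nat ((int l + b) mod int p)"
      and j = "\<lambda>a. nat ((int a - b) mod int p)"])
  fix a assume "a \<in> {..<p}"
  then show "nat ((int (nat ((int a - b) mod int p)) + b) mod int p) = a"
    using p by (simp add: mod_add_left_eq)
  show "g (int (nat ((int a - b) mod int p))) = g (int a - b)"
    using p g[of "int a - b"] by simp
  show "nat ((int a - b) mod int p) \<in> {..<p}" using p by (simp add: nat_less_iff)
next
  fix l assume "l \<in> {..<p}"
  then show "nat ((int (nat ((int l + b) mod int p)) - b) mod int p) = l"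
    using p by (simp add: mod_diff_left_eq)
  show "nat ((int l + b) mod int p) \<in> {..<p}" using p by (simp add: nat_less_iff)
qed

lemma sum_periodic_reflect:
  fixes g :: "int \<Rightarrow> 'a::comm_monoid_add"
  assumes p: "0 < p" and g: "\<And>n. g (n mod int p) = g n"
  shows "(\<Sum>a<p. g (- int a)) = (\<Sum>l<p. g (int l))"
proof (rule sum.reindex_bij_witness[where i = "\<lambda>l. nat ((- int l) mod int p)"
      and j = "\<lambda>a. nat ((- int a) mod int p)"])
  fix a assume "a \<in> {..<p}"
  then show "nat (- int (nat (- int a mod int p)) mod int p) = a"
    "nat (- int (nat (- int a mod int p)) mod int p) = a"
    using p by (simp_all add: mod_minus_eq)
  show "g (int (nat (- int a mod int p))) = g (- int a)"
    using p g[of "- int a"] by simp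
  show "nat (- int a mod int p) \<in> {..<p}" "nat (- int a mod int p) \<in> {..<p}"
    using p by (simp_all add: nat_less_iff)
qed

section \<open>Block coordinates \<open>a * m + s\<close> and Kronecker products with the
  identity\<close>

lemma sum_blocks:
  fixes g :: "nat \<Rightarrow> 'a::comm_monoid_add"
  shows "(\<Sum>r<m * p. g r) = (\<Sum>a<p. \<Sum>s<m. g (a * m + s))"
proof -
  have "(\<Sum>r<m * p. g r) = (\<Sum>a<p. sum g {a * m..<a * m + m})"
    using sum.nat_group[of g m p] by (simp add: mult.commute)
  also have "\<dots> = (\<Sum>a<p. \<Sum>s<m. g (a * m + s))"
  proof (intro sum.cong[OF refl])
    fix a
    show "sum g {a * m..<a * m + m} = (\<Sum>s<m. g (a * m + s))"
      using sum.shift_bounds_nat_ivl[of g 0 "a * m" m] by (simp add: lessThan_atLeast0 add.commute)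
  qed
  finally show ?thesis .
qed

lemma block_index_less: "a < p \<Longrightarrow> s < m \<Longrightarrow> a * m + s < m * (p::nat)"
proof -
  assume "a < p" "s < m"
  then have "a * m + s < Suc a * m" by simp
  also have "\<dots> \<le> p * m" using \<open>a < p\<close> by (intro mult_le_mono1) simp
  finally show ?thesis by (simp add: mult.commute)
qed

lemma kron_one_carrier [simp]:
  "F \<in> carrier_mat p p \<Longrightarrow> kron F (1\<^sub>m m) \<in> carrier_mat (m * p) (m * p)"
  by (rule carrier_matI) (auto simp: kron_def mult.commute)

lemma kron_one_index:
  assumes "F \<in> carrier_mat p p" "a < p" "b < p" "s < m" "t < m"
  shows "kron F (1\<^sub>m m) $$ (a * m + s, b * m + t) = (if s = t then F $$ (a, b) else 0)"
  using assms block_index_less[of a p s m] block_index_less[of b p t m]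
  by (simp add: kron_def mult.commute)

lemma kron_one_mult_left:
  assumes F: "F \<in> carrier_mat p p" and X: "X \<in> carrier_mat (m * p) n"
    and i: "a < p" "s < m" "c < n"
  shows "(kron F (1\<^sub>m m) * X) $$ (a * m + s, c) = (\<Sum>b<p. F $$ (a, b) * X $$ (b * m + s, c))"
proof -
  have "(kron F (1\<^sub>m m) * X) $$ (a * m + s, c)
      = (\<Sum>b<p. \<Sum>t<m. kron F (1\<^sub>m m) $$ (a * m + s, b * m + t) * X $$ (b * m + t, c))"
    unfolding mat_mult_index_sum[OF kron_one_carrier[OF F] X block_index_less[OF i(1,2)] i(3)]
    by (rule sum_blocks)
  also have "\<dots> = (\<Sum>b<p. \<Sum>t<m. if t = s then F $$ (a, b) * X $$ (b * m + s, c) else 0)"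
    using F i by (intro sum.cong refl) (auto simp: kron_one_index)
  finally show ?thesis using i by simp
qed

lemma kron_one_mult_right:
  assumes F: "F \<in> carrier_mat p p" and X: "X \<in> carrier_mat n (m * p)"
    and i: "a < p" "s < m" "r < n"
  shows "(X * kron F (1\<^sub>m m)) $$ (r, a * m + s) = (\<Sum>b<p. X $$ (r, b * m + s) * F $$ (b, a))"
proof -
  have "(X * kron F (1\<^sub>m m)) $$ (r, a * m + s)
      = (\<Sum>b<p. \<Sum>t<m. X $$ (r, b * m + t) * kron F (1\<^sub>m m) $$ (b * m + t, a * m + s))"
    unfolding mat_mult_index_sum[OF X kron_one_carrier[OF F] i(3) block_index_less[OF i(1,2)]]
    by (rule sum_blocks)
  also have "\<dots> = (\<Sum>b<p. \<Sum>t<m. if t = s then X $$ (r, b * m + s) * F $$ (b, a) else 0)"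
    using F i by (intro sum.cong refl) (auto simp: kron_one_index)
  finally show ?thesis using i by simp
qed

lemma DFT_carrier [simp]: "DFT p \<in> carrier_mat p p"
  by (simp add: DFT_def)

lemma DFT_index:
  "a < p \<Longrightarrow> b < p \<Longrightarrow> DFT p $$ (a, b) = root_of_one p (int a * int b) / complex_of_real (sqrt (real p))"
  by (simp add: DFT_def root_of_one_def mult.assoc)

lemma adj_DFT_index:
  "a < p \<Longrightarrow> b < p \<Longrightarrow> adj (DFT p) $$ (a, b) = root_of_one p (- (int a * int b)) / complex_of_real (sqrt (real p))"
  using DFT_index[of b p a] by (simp add: DFT_def[of p, THEN arg_cong[of _ _ dim_row]]
      DFT_def[of p, THEN arg_cong[of _ _ dim_col]] cnj_root_of_one mult.commute)

lemma sqrt_of_nat_mult_self: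
  "complex_of_real (sqrt (real p)) * complex_of_real (sqrt (real p)) = of_nat p"
  by (simp flip: of_real_mult)

lemma bcirc_carrier [simp]: "bcirc m m p H \<in> carrier_mat (m * p) (m * p)"
  by (simp add: bcirc_def)

lemma bcirc_index:
  assumes "a < p" "b < p" "i < m" "j < m"
  shows "bcirc m m p H $$ (a * m + i, b * m + j) = H i j (nat ((int a - int b) mod int p))"
  using assms block_index_less[of a p i m] block_index_less[of b p j m] by (simp add: bcirc_def)

lemma fourier_block_carrier [simp]: "fourier_block m p H k \<in> carrier_mat m m"
  by (simp add: fourier_block_def Let_def)

lemma fourier_block_dim [simp]:
  "dim_row (fourier_block m p H k) = m" "dim_col (fourier_block m p H k) = m"
  by (simp_all add: fourier_block_def Let_def)

text \<open>The Fourier blocks are the unnormalized discrete Fourier transform of the frontal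
  slices. The two factors 1/sqrt(p) of the DFT matrices combine to 1/p, and this cancels against the
  sum over the \<open>p\<close> column blocks, whose contributions are all equal.\<close>

lemma fourier_block_index:
  assumes k: "k < p" and ij: "i < m" "j < m"
  shows "fourier_block m p H k $$ (i, j) = (\<Sum>l<p. root_of_one p (int k * int l) * H i j l)"
proof -
  have p: "0 < p" using k by simp
  let ?X = "bcirc m m p H"
  let ?s = "complex_of_real (sqrt (real p))"
  \<comment> \<open>A summand depends on its row and column block only through their difference
    modulo \<open>p\<close>.\<close>
  define g where "g n = root_of_one p (int k * n) * H i j (nat (n mod int p))" for n
  have g: "g (n mod int p) = g n" for n by (simp add: g_def root_of_one_mod[OF p])
  have "fourier_block m p H k $$ (i, j)
      = (kron (DFT p) (1\<^sub>m m) * ?X * kron (adj (DFT p)) (1\<^sub>m m)) $$ (k * m + i, k * m + j)"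
    using ij by (simp add: fourier_block_def Let_def)
  also have "\<dots> = (\<Sum>b<p. (kron (DFT p) (1\<^sub>m m) * ?X) $$ (k * m + i, b * m + j) * adj (DFT p) $$ (b, k))"
    using k ij by (intro kron_one_mult_right[where n = "m * p"] mult_carrier_square block_index_less) auto
  also have "\<dots> = (\<Sum>b<p. (\<Sum>a<p. DFT p $$ (k, a) * ?X $$ (a * m + i, b * m + j)) * adj (DFT p) $$ (b, k))"
    using k ij by (intro sum.cong refl arg_cong2[where f = "(*)"] kron_one_mult_left[where n = "m * p"] block_index_less) auto
  also have "\<dots> = (\<Sum>b<p. \<Sum>a<p. g (int a - int b) / of_nat p)"
  proof (intro sum.cong refl)
    fix b assume "b \<in> {..<p}"
    then have b: "b < p" by simp
    show "(\<Sum>a<p. DFT p $$ (k, a) * ?X $$ (a * m + i, b * m + j)) * adj (DFT p) $$ (b, k)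
        = (\<Sum>a<p. g (int a - int b) / of_nat p)"
      unfolding sum_distrib_right
    proof (intro sum.cong refl)
      fix a assume "a \<in> {..<p}"
      then have a: "a < p" by simp
      have "int k * int a + - (int b * int k) = int k * (int a - int b)" by (simp add: algebra_simps)
      then have "root_of_one p (int k * (int a - int b)) = root_of_one p (int k * int a) * root_of_one p (- (int b * int k))"
        by (metis root_of_one_add)
      then show "DFT p $$ (k, a) * ?X $$ (a * m + i, b * m + j) * adj (DFT p) $$ (b, k) = g (int a - int b) / of_nat p"
        unfolding DFT_index[OF k a] adj_DFT_index[OF b k] bcirc_index[OF a b ij] g_def
          sqrt_of_nat_mult_self[of p, symmetric]
        by (simp add: mult.assoc mult.left_commute mult.commute)
    qed
  qed
  also have "\<dots> = (\<Sum>b<p. (\<Sum>l<p. g (int l)) / of_nat p)"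
    unfolding sum_divide_distrib[symmetric] sum_periodic_shift[where g = g, OF p g] ..
  also have "\<dots> = (\<Sum>l<p. g (int l))" using p by simp
  also have "\<dots> = (\<Sum>l<p. root_of_one p (int k * int l) * H i j l)"
    by (intro sum.cong refl) (simp add: g_def)
  finally show ?thesis .
qed

lemma block_diag_carrier [simp]: "block_diag m p B \<in> carrier_mat (m * p) (m * p)"
  by (simp add: block_diag_def)

lemma block_diag_index:
  assumes "a < p" "b < p" "i < m" "j < m"
  shows "block_diag m p B $$ (a * m + i, b * m + j) = (if a = b then B a $$ (i, j) else 0)"
  using assms block_index_less[of a p i m] block_index_less[of b p j m] by (simp add: block_diag_def)

text \<open>The inverse Fourier transform of the blocks. \<open>bcirc_inv\<close> reads the first
  block column, so the right-hand DFT factor enters only through its constant column 0.\<close>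

lemma tensor_fun_index:
  assumes l: "l < p" and ij: "i < m" "j < m"
  shows "tensor_fun m p f H i j l = (\<Sum>a<p. root_of_one p (- (int a * int l))
      * mat_fun f (fourier_block m p (ctensor_of H) a) $$ (i, j)) / of_nat p"
proof -
  have p: "0 < p" using l by simp
  define Bk where "Bk = (\<lambda>k. mat_fun f (fourier_block m p (ctensor_of H) k))"
  let ?X = "block_diag m p Bk"
  have "tensor_fun m p f H i j l
      = (kron (adj (DFT p)) (1\<^sub>m m) * ?X * kron (DFT p) (1\<^sub>m m)) $$ (l * m + i, 0 * m + j)"
    by (simp add: tensor_fun_def bcirc_inv_def Bk_def)
  also have "\<dots> = (\<Sum>b<p. (kron (adj (DFT p)) (1\<^sub>m m) * ?X) $$ (l * m + i, b * m + j) * DFT p $$ (b, 0))"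
    using p l ij by (intro kron_one_mult_right[where n = "m * p"] mult_carrier_square block_index_less) auto
  also have "\<dots> = (\<Sum>b<p. (\<Sum>a<p. adj (DFT p) $$ (l, a) * ?X $$ (a * m + i, b * m + j)) * DFT p $$ (b, 0))"
    using l ij by (intro sum.cong refl arg_cong2[where f = "(*)"] kron_one_mult_left[where n = "m * p"] block_index_less) auto
  also have "\<dots> = (\<Sum>b<p. root_of_one p (- (int b * int l)) * Bk b $$ (i, j) / of_nat p)"
  proof (intro sum.cong refl)
    fix b assume "b \<in> {..<p}"
    then have b: "b < p" by simp
    have "(\<Sum>a<p. adj (DFT p) $$ (l, a) * ?X $$ (a * m + i, b * m + j))
        = (\<Sum>a<p. if a = b then adj (DFT p) $$ (l, b) * Bk b $$ (i, j) else 0)"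
      using b ij by (intro sum.cong refl) (auto simp: block_diag_index)
    also have "\<dots> = adj (DFT p) $$ (l, b) * Bk b $$ (i, j)" using b by simp
    finally show "(\<Sum>a<p. adj (DFT p) $$ (l, a) * ?X $$ (a * m + i, b * m + j)) * DFT p $$ (b, 0)
        = root_of_one p (- (int b * int l)) * Bk b $$ (i, j) / of_nat p"
      unfolding adj_DFT_index[OF l b] DFT_index[OF b p] sqrt_of_nat_mult_self[of p, symmetric]
      by (simp add: root_of_one_def mult.commute)
  qed
  finally show ?thesis by (simp add: sum_divide_distrib Bk_def)
qed

text \<open>Fourier inversion along the third index: after the sums are interchanged, orthogonality
  of the characters leaves only the term \<open>a = k\<close>.\<close>

lemma fourier_block_tensor_fun:
  assumes k: "k < p" and B: "mat_fun f (fourier_block m p (ctensor_of H) k) \<in> carrier_mat m m"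
  shows "fourier_block m p (tensor_fun m p f H) k = mat_fun f (fourier_block m p (ctensor_of H) k)"
proof (rule eq_matI)
  define Bk where "Bk = (\<lambda>k. mat_fun f (fourier_block m p (ctensor_of H) k))"
  fix i j assume "i < dim_row (mat_fun f (fourier_block m p (ctensor_of H) k))"
    "j < dim_col (mat_fun f (fourier_block m p (ctensor_of H) k))"
  then have ij: "i < m" "j < m" using B by auto
  have p: "0 < p" using k by simp
  have "fourier_block m p (tensor_fun m p f H) k $$ (i, j)
      = (\<Sum>l<p. root_of_one p (int k * int l) * ((\<Sum>a<p. root_of_one p (- (int a * int l)) * Bk a $$ (i, j)) / of_nat p))"
    unfolding fourier_block_index[OF k ij] Bk_def using ij
    by (intro sum.cong refl) (simp add: tensor_fun_index)
  also have "\<dots> = (\<Sum>l<p. \<Sum>a<p. root_of_one p ((int k - int a) * int l) * (Bk a $$ (i, j) / of_nat p))"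
  proof (intro sum.cong refl)
    fix l
    have "root_of_one p ((int k - int a) * int l) = root_of_one p (int k * int l) * root_of_one p (- (int a * int l))" for a
      by (metis root_of_one_add diff_conv_add_uminus left_diff_distrib)
    then show "root_of_one p (int k * int l) * ((\<Sum>a<p. root_of_one p (- (int a * int l)) * Bk a $$ (i, j)) / of_nat p)
        = (\<Sum>a<p. root_of_one p ((int k - int a) * int l) * (Bk a $$ (i, j) / of_nat p))"
      by (simp add: sum_divide_distrib sum_distrib_left mult.assoc)
  qed
  also have "\<dots> = (\<Sum>a<p. (\<Sum>l<p. root_of_one p ((int k - int a) * int l)) * (Bk a $$ (i, j) / of_nat p))"
    unfolding sum_distrib_right by (rule sum.swap)
  also have "\<dots> = (\<Sum>a<p. if a = k then Bk k $$ (i, j) else 0)"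
    using k p by (intro sum.cong refl) (subst sum_root_of_one; auto)
  also have "\<dots> = Bk k $$ (i, j)" using k by simp
  finally show "fourier_block m p (tensor_fun m p f H) k $$ (i, j)
      = mat_fun f (fourier_block m p (ctensor_of H) k) $$ (i, j)" by (simp add: Bk_def)
qed (use B fourier_block_carrier[of m p "tensor_fun m p f H" k] in auto)

text \<open>Block (l, 0) of the transposed block-circulant matrix is the transpose of block (0, l),
  which holds the slice with index -l modulo \<open>p\<close>.\<close>

lemma tsymmetric_reflect:
  assumes "tsymmetric m p H" "i < m" "j < m" "l < p"
  shows "H i j l = H j i (nat ((- int l) mod int p))"
proof -
  have p: "0 < p" using assms by simp
  have less: "l * m + i < m * p" "j < m * p"
    using assms block_index_less[of l p i m] block_index_less[of 0 p j m] by auto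
  have "complex_of_real (H i j l) = ttranspose m m p (ctensor_of H) i j l"
    using assms unfolding tsymmetric_def by (simp add: ctensor_of_def)
  also have "\<dots> = bcirc m m p (ctensor_of H) $$ (0 * m + j, l * m + i)"
    using less by (simp add: ttranspose_def bcirc_inv_def bcirc_def)
  also have "\<dots> = complex_of_real (H j i (nat ((- int l) mod int p)))"
    unfolding bcirc_index[OF p assms(4,3,2)] by (simp add: ctensor_of_def)
  finally show ?thesis by (simp only: of_real_eq_iff)
qed

text \<open>Conjugation negates the exponent of each root of unity, while symmetry of the tensor
  negates the slice index. Reindexing by the reflection of the residues makes the two effects
  cancel, the entries being real.\<close>

lemma fourier_block_hermitian:
  assumes sym: "tsymmetric m p H" and k: "k < p"
  shows "adj (fourier_block m p (ctensor_of H) k) = fourier_block m p (ctensor_of H) k"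
proof (rule eq_matI)
  have carr: "fourier_block m p (ctensor_of H) k \<in> carrier_mat m m" by simp
  fix i j assume "i < dim_row (fourier_block m p (ctensor_of H) k)"
    "j < dim_col (fourier_block m p (ctensor_of H) k)"
  then have ij: "i < m" "j < m" using carr by auto
  have p: "0 < p" using k by simp
  define g where "g n = root_of_one p (int k * n) * complex_of_real (H i j (nat (n mod int p)))" for n
  have g: "g (n mod int p) = g n" for n by (simp add: g_def root_of_one_mod[OF p])
  have "adj (fourier_block m p (ctensor_of H) k) $$ (i, j) = cnj (fourier_block m p (ctensor_of H) k $$ (j, i))"
    using carr ij by (intro adj_index) auto
  also have "\<dots> = (\<Sum>l<p. root_of_one p (- (int k * int l)) * complex_of_real (H j i l))"
    unfolding fourier_block_index[OF k ij(2,1)] by (simp add: cnj_root_of_one ctensor_of_def)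
  also have "\<dots> = (\<Sum>l<p. g (- int l))"
    using tsymmetric_reflect[OF sym ij(2,1)] by (intro sum.cong refl) (simp add: g_def)
  also have "\<dots> = (\<Sum>l<p. g (int l))" by (rule sum_periodic_reflect[where g = g, OF p g])
  also have "\<dots> = fourier_block m p (ctensor_of H) k $$ (i, j)"
    unfolding fourier_block_index[OF k ij] by (intro sum.cong refl) (simp add: g_def ctensor_of_def)
  finally show "adj (fourier_block m p (ctensor_of H) k) $$ (i, j) = fourier_block m p (ctensor_of H) k $$ (i, j)" .
qed (use fourier_block_carrier[of m p "ctensor_of H" k] in auto)

section \<open>T-eigenvalues and T-singular values\<close>

lemma mset_sorted_desc [simp]: "mset (sorted_desc M) = M"
  by (simp add: sorted_desc_def)

lemma sorted_rev_sorted_desc: "sorted (rev (sorted_desc M))"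
  by (simp add: sorted_desc_def)

lemma sorted_desc_le_hd:
  assumes "x \<in># M"
  shows "x \<le> hd (sorted_desc M)"
proof -
  have x: "x \<in> set (sorted_desc M)" using assms by (metis mset_sorted_desc set_mset_mset)
  then obtain y ys where l: "sorted_desc M = y # ys" by (cases "sorted_desc M") auto
  have "sorted (rev ys @ [y])" using sorted_rev_sorted_desc[of M] by (simp add: l)
  then show ?thesis using x by (auto simp: l sorted_append)
qed

lemma t_eigvals_decreasing:
  assumes "i \<le> j" "j < length (t_eigvals m p H)"
  shows "t_eigvals m p H ! j \<le> t_eigvals m p H ! i"
proof -
  have "sorted (rev (t_eigvals m p H))" unfolding t_eigvals_def by (rule sorted_rev_sorted_desc)
  from sorted_rev_nth_mono[OF this assms] show ?thesis .
qed

text \<open>The eigenvalues \<open>d k i\<close> are not sorted, so spectra are compared as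
  multisets. A complex tensor is allowed in order to include the values of
  \<open>tensor_fun\<close>.\<close>

definition spectral_decomposition ::
    "nat \<Rightarrow> nat \<Rightarrow> ctensor \<Rightarrow> (nat \<Rightarrow> complex mat) \<Rightarrow> (nat \<Rightarrow> nat \<Rightarrow> real) \<Rightarrow> bool" where
  "spectral_decomposition m p H U d \<longleftrightarrow> (\<forall>k<p. U k \<in> carrier_mat m m \<and> unitary (U k) \<and>
     fourier_block m p H k = U k * rdiag m (d k) * adj (U k))"

lemma tsymmetric_spectral_decomposition:
  assumes "tsymmetric m p H"
  shows "\<exists>U d. spectral_decomposition m p (ctensor_of H) U d"
proof -
  have "\<forall>k. \<exists>Ud. k < p \<longrightarrow> fst Ud \<in> carrier_mat m m \<and> unitary (fst Ud) \<and>
      fourier_block m p (ctensor_of H) k = fst Ud * rdiag m (snd Ud) * adj (fst Ud)"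
    using hermitian_diagonalization[OF fourier_block_carrier fourier_block_hermitian[OF assms]]
    by (metis fst_conv snd_conv)
  then obtain Ud where "\<And>k. k < p \<Longrightarrow> fst (Ud k) \<in> carrier_mat m m \<and> unitary (fst (Ud k)) \<and>
      fourier_block m p (ctensor_of H) k = fst (Ud k) * rdiag m (snd (Ud k)) * adj (fst (Ud k))"
    by metis
  then have "spectral_decomposition m p (ctensor_of H) (\<lambda>k. fst (Ud k)) (\<lambda>k. snd (Ud k))"
    by (simp add: spectral_decomposition_def)
  then show ?thesis by blast
qed

lemma mset_t_eigvals:
  assumes "spectral_decomposition m p (ctensor_of H) U d"
  shows "mset (t_eigvals m p H) = (\<Sum>k<p. mset (map (d k) [0..<m]))"
  unfolding t_eigvals_def mset_sorted_desc
proof (intro sum.cong refl)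
  fix k assume "k \<in> {..<p}"
  then have "eigvals_mset (fourier_block m p (ctensor_of H) k) = mset (map (\<lambda>i. complex_of_real (d k i)) [0..<m])"
    using assms eigvals_mset_unitary_conj by (auto simp: spectral_decomposition_def)
  then show "image_mset Re (eigvals_mset (fourier_block m p (ctensor_of H) k)) = mset (map (d k) [0..<m])"
    by (simp flip: mset_map add: o_def)
qed

lemma size_sum_mset_family:
  fixes f :: "nat \<Rightarrow> 'b multiset"
  shows "size (\<Sum>k<p. f k) = (\<Sum>k<p. size (f k))"
  by (induction p) auto

lemma image_mset_sum_family:
  fixes f :: "nat \<Rightarrow> 'b multiset"
  shows "image_mset g (\<Sum>k<p. f k) = (\<Sum>k<p. image_mset g (f k))"
  by (induction p) auto

lemma length_t_eigvals:
  assumes "tsymmetric m p H"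
  shows "length (t_eigvals m p H) = m * p"
proof -
  obtain U d where "spectral_decomposition m p (ctensor_of H) U d"
    using tsymmetric_spectral_decomposition[OF assms] by blast
  from arg_cong[OF mset_t_eigvals[OF this], of size] show ?thesis
    by (simp add: size_sum_mset_family mult.commute)
qed

text \<open>With a real diagonal part the block equals its own adjoint, so the product under the
  root has eigenvalues \<open>d k i * d k i\<close>.\<close>

lemma mset_t_singvals:
  assumes "spectral_decomposition m p H U d"
  shows "mset (t_singvals m p H) = (\<Sum>k<p. mset (map (\<lambda>i. \<bar>d k i\<bar>) [0..<m]))"
  unfolding t_singvals_def mset_sorted_desc
proof (intro sum.cong refl)
  fix k assume "k \<in> {..<p}"
  then have U: "U k \<in> carrier_mat m m" "unitary (U k)"
    and H: "fourier_block m p H k = U k * rdiag m (d k) * adj (U k)"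
    using assms by (auto simp: spectral_decomposition_def)
  have U': "adj (U k) \<in> carrier_mat m m" using U by simp
  have "adj (U k * rdiag m (d k) * adj (U k)) = U k * rdiag m (d k) * adj (U k)"
    unfolding adj_mult[OF mult_carrier_square[OF U(1) rdiag_carrier] U'] adj_mult[OF U(1) rdiag_carrier]
      adj_rdiag adj_adj
    by (rule assoc_mult_mat[OF U(1) rdiag_carrier U', symmetric])
  then have "adj (fourier_block m p H k) * fourier_block m p H k
      = U k * rdiag m (\<lambda>i. d k i * d k i) * adj (U k)"
    unfolding H by (simp only: unitary_conj_mult[OF U rdiag_carrier rdiag_carrier] rdiag_mult)
  then have "eigvals_mset (adj (fourier_block m p H k) * fourier_block m p H k)
      = mset (map (\<lambda>i. complex_of_real (d k i * d k i)) [0..<m])"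
    using eigvals_mset_unitary_conj[OF U] by simp
  then show "image_mset (\<lambda>z. sqrt (Re z)) (eigvals_mset (adj (fourier_block m p H k) * fourier_block m p H k))
      = mset (map (\<lambda>i. \<bar>d k i\<bar>) [0..<m])"
    by (simp flip: mset_map add: o_def)
qed

lemma t_singvals_ctensor_of:
  assumes "tsymmetric m p H"
  shows "mset (t_singvals m p (ctensor_of H)) = image_mset abs (mset (t_eigvals m p H))"
proof -
  obtain U d where "spectral_decomposition m p (ctensor_of H) U d"
    using tsymmetric_spectral_decomposition[OF assms] by blast
  then show ?thesis
    by (simp add: mset_t_eigvals mset_t_singvals image_mset_sum_family multiset.map_comp o_def)
qed

text \<open>Converts the boundedness assumption on the operator norms into a uniform bound on all
  T-eigenvalues.\<close>

lemma abs_t_eigvals_le_t_opnorm: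
  assumes "tsymmetric m p H" "i < m * p"
  shows "\<bar>t_eigvals m p H ! i\<bar> \<le> t_opnorm m p H"
proof -
  have "\<bar>t_eigvals m p H ! i\<bar> \<in># mset (t_singvals m p (ctensor_of H))"
    unfolding t_singvals_ctensor_of[OF assms(1)] using length_t_eigvals[OF assms(1)] assms(2)
    by (auto intro: nth_mem)
  then show ?thesis unfolding t_opnorm_def t_singvals_def mset_sorted_desc by (rule sorted_desc_le_hd)
qed

text \<open>
  The choice in \<^const>\<open>mat_fun\<close> may pick any diagonalization; only its spectrum matters here, so
  independence of the choice is not needed.
\<close>

lemma mat_fun_hermitian:
  assumes "A \<in> carrier_mat n n" "adj A = A"
  shows "\<exists>U d. U \<in> carrier_mat n n \<and> unitary U \<and> A = U * rdiag n d * adj U \<and>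
      mat_fun f A = U * rdiag n (f \<circ> d) * adj U"
proof -
  have n: "dim_row A = n" using assms by simp
  obtain U d where "U \<in> carrier_mat n n" "unitary U" "A = U * rdiag n d * adj U"
    using hermitian_diagonalization[OF assms] by blast
  then have "\<exists>B. \<exists>U d. U \<in> carrier_mat n n \<and> unitary U \<and> A = U * rdiag n d * adj U \<and>
      B = U * rdiag n (f \<circ> d) * adj U" by blast
  from someI_ex[OF this] show ?thesis unfolding mat_fun_def n .
qed

text \<open>The diagonalization has to be the one picked inside \<open>mat_fun\<close>: it then
  decomposes a block of \<open>H\<close> and its image under \<open>f\<close> simultaneously, with
  eigenvalues matched index by index.\<close>

lemma mset_t_singvals_tensor_fun:
  assumes "tsymmetric m p H"
  shows "mset (t_singvals m p (tensor_fun m p f H)) = image_mset (\<lambda>x. \<bar>f x\<bar>) (mset (t_eigvals m p H))"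
proof -
  let ?A = "fourier_block m p (ctensor_of H)"
  have "\<forall>k. \<exists>Ud. k < p \<longrightarrow> fst Ud \<in> carrier_mat m m \<and> unitary (fst Ud) \<and>
      ?A k = fst Ud * rdiag m (snd Ud) * adj (fst Ud) \<and>
      mat_fun f (?A k) = fst Ud * rdiag m (f \<circ> snd Ud) * adj (fst Ud)"
    using mat_fun_hermitian[OF fourier_block_carrier fourier_block_hermitian[OF assms], of _ f]
    by (metis fst_conv snd_conv)
  then obtain Ud where Ud: "\<And>k. k < p \<Longrightarrow> fst (Ud k) \<in> carrier_mat m m \<and> unitary (fst (Ud k)) \<and>
      ?A k = fst (Ud k) * rdiag m (snd (Ud k)) * adj (fst (Ud k)) \<and>
      mat_fun f (?A k) = fst (Ud k) * rdiag m (f \<circ> snd (Ud k)) * adj (fst (Ud k))"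
    by metis
  have "fourier_block m p (tensor_fun m p f H) k = fst (Ud k) * rdiag m (f \<circ> snd (Ud k)) * adj (fst (Ud k))"
    if k: "k < p" for k
  proof -
    from Ud[OF k] have V: "fst (Ud k) \<in> carrier_mat m m"
      and mf: "mat_fun f (?A k) = fst (Ud k) * rdiag m (f \<circ> snd (Ud k)) * adj (fst (Ud k))" by blast+
    have "mat_fun f (?A k) \<in> carrier_mat m m" unfolding mf using V by simp
    from fourier_block_tensor_fun[OF k this] show ?thesis unfolding mf .
  qed
  then have "spectral_decomposition m p (tensor_fun m p f H) (\<lambda>k. fst (Ud k)) (\<lambda>k. f \<circ> snd (Ud k))"
    using Ud by (simp add: spectral_decomposition_def)
  moreover have "spectral_decomposition m p (ctensor_of H) (\<lambda>k. fst (Ud k)) (\<lambda>k. snd (Ud k))"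
    using Ud by (simp add: spectral_decomposition_def)
  ultimately show ?thesis
    by (simp add: mset_t_eigvals mset_t_singvals image_mset_sum_family multiset.map_comp o_def)
qed

text \<open>On the right there is neither an ordering nor a choice of eigenvectors: the traces are
  polynomials in the entries of the blocks.\<close>

lemma sum_t_eigvals_power:
  assumes "tsymmetric m p H"
  shows "(\<Sum>i<m * p. t_eigvals m p H ! i ^ n)
      = Re (\<Sum>k<p. \<Sum>i<m. (fourier_block m p (ctensor_of H) k ^\<^sub>m n) $$ (i, i))"
proof -
  obtain U d where Ud: "spectral_decomposition m p (ctensor_of H) U d"
    using tsymmetric_spectral_decomposition[OF assms] by blast
  have "(\<Sum>i<m * p. t_eigvals m p H ! i ^ n) = sum_list (map (\<lambda>x. x ^ n) (t_eigvals m p H))"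
    by (simp add: sum_list_sum_nth length_t_eigvals[OF assms] lessThan_atLeast0)
  also have "\<dots> = (\<Sum>x\<in>#mset (t_eigvals m p H). x ^ n)"
    by (simp flip: sum_mset_sum_list)
  also have "\<dots> = (\<Sum>x\<in>#(\<Sum>k<p. mset (map (d k) [0..<m])). x ^ n)"
    by (simp only: mset_t_eigvals[OF Ud])
  also have "\<dots> = (\<Sum>k<p. \<Sum>i<m. d k i ^ n)"
  proof (induction p)
    case (Suc p)
    have "(\<Sum>x\<in>#mset (map (d p) [0..<m]). x ^ n) = sum_list (map (\<lambda>i. d p i ^ n) [0..<m])"
      unfolding mset_map[symmetric] sum_mset_sum_list by (simp add: o_def)
    also have "\<dots> = (\<Sum>i<m. d p i ^ n)"
      by (simp add: interv_sum_list_conv_sum_set_nat lessThan_atLeast0)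
    finally show ?case using Suc by simp
  qed simp
  also have "\<dots> = Re (\<Sum>k<p. complex_of_real (\<Sum>i<m. d k i ^ n))"
    by (simp only: of_real_sum[symmetric] Re_complex_of_real)
  also have "(\<Sum>k<p. complex_of_real (\<Sum>i<m. d k i ^ n))
      = (\<Sum>k<p. \<Sum>i<m. (fourier_block m p (ctensor_of H) k ^\<^sub>m n) $$ (i, i))"
  proof (intro sum.cong refl)
    fix k assume "k \<in> {..<p}"
    then have U: "U k \<in> carrier_mat m m" "unitary (U k)"
      and H: "fourier_block m p (ctensor_of H) k = U k * rdiag m (d k) * adj (U k)"
      using Ud by (auto simp: spectral_decomposition_def)
    show "complex_of_real (\<Sum>i<m. d k i ^ n) = (\<Sum>i<m. (fourier_block m p (ctensor_of H) k ^\<^sub>m n) $$ (i, i))"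
      unfolding H pow_unitary_conj[OF U] trace_unitary_conj[OF U] ..
  qed
  finally show ?thesis .
qed

section \<open>Measurability of the T-eigenvalues\<close>

text \<open>
  Power sums of the eigenvalues are traces of matrix powers, hence measurable; by Weierstrass so are
  sums of continuous functions of the eigenvalues, and in the limit the number of eigenvalues above
  a threshold, which determines the ordered eigenvalues.
\<close>

lemma measurable_sum_continuous:
  fixes y :: "'a \<Rightarrow> nat \<Rightarrow> real"
  assumes pow: "\<And>e. (\<lambda>\<omega>. \<Sum>i<n. y \<omega> i ^ e) \<in> borel_measurable M"
    and g: "continuous_on UNIV (g :: real \<Rightarrow> real)"
  shows "(\<lambda>\<omega>. \<Sum>i<n. g (y \<omega> i)) \<in> borel_measurable M"
proof -
  \<comment> \<open>The interval grows while the error shrinks, so every fixed value eventually lies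
    in the range of approximation; pointwise convergence is all that is required.\<close>
  have "\<exists>q. real_polynomial_function q \<and> (\<forall>x\<in>{- real N..real N}. \<bar>g x - q x\<bar> < 1 / real (Suc N))" for N
    using Stone_Weierstrass_real_polynomial_function[of "{- real N..real N}" g "1 / real (Suc N)"]
      continuous_on_subset[OF g] by (metis compact_Icc of_nat_0_less_iff subset_UNIV zero_less_Suc zero_less_divide_1_iff)
  then obtain q where q: "\<And>N. real_polynomial_function (q N)"
    and close: "\<And>N x. \<bar>x\<bar> \<le> real N \<Longrightarrow> \<bar>g x - q N x\<bar> < 1 / real (Suc N)"
    by (metis abs_le_iff atLeastAtMost_iff minus_le_iff)
  show ?thesis
  proof (rule borel_measurable_LIMSEQ_real)
    show "(\<lambda>\<omega>. \<Sum>i<n. q N (y \<omega> i)) \<in> borel_measurable M" for N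
    proof -
      obtain a d where qa: "q N = (\<lambda>x. \<Sum>e\<le>(d::nat). a e * x ^ e)"
        using q[of N] real_polynomial_function_iff_sum by blast
      have "(\<lambda>\<omega>. \<Sum>i<n. q N (y \<omega> i)) = (\<lambda>\<omega>. \<Sum>e\<le>d. a e * (\<Sum>i<n. y \<omega> i ^ e))"
        unfolding qa sum_distrib_left by (intro ext sum.swap)
      also have "\<dots> \<in> borel_measurable M"
        by (rule borel_measurable_sum, rule borel_measurable_times[OF borel_measurable_const pow])
      finally show ?thesis .
    qed
    show "(\<lambda>N. \<Sum>i<n. q N (y \<omega> i)) \<longlonglongrightarrow> (\<Sum>i<n. g (y \<omega> i))" for \<omega>
    proof (rule tendsto_sum)
      fix i
      have "(\<lambda>N. g (y \<omega> i) - q N (y \<omega> i)) \<longlonglongrightarrow> 0"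
      proof (rule Lim_null_comparison)
        show "\<forall>\<^sub>F N in sequentially. norm (g (y \<omega> i) - q N (y \<omega> i)) \<le> 1 / real (Suc N)"
          using eventually_ge_at_top[of "nat \<lceil>\<bar>y \<omega> i\<bar>\<rceil>"]
        proof eventually_elim
          case (elim N)
          then have "\<bar>y \<omega> i\<bar> \<le> real N" by linarith
          from close[OF this] show ?case by simp
        qed
        show "(\<lambda>N. 1 / real (Suc N)) \<longlonglongrightarrow> 0" by (rule LIMSEQ_Suc[OF lim_1_over_n])
      qed
      from tendsto_diff[OF tendsto_const[of "g (y \<omega> i)"] this]
      show "(\<lambda>N. q N (y \<omega> i)) \<longlonglongrightarrow> g (y \<omega> i)" by simp
    qed
  qed
qed

lemma measurable_count_greater:
  fixes y :: "'a \<Rightarrow> nat \<Rightarrow> real"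
  assumes pow: "\<And>e. (\<lambda>\<omega>. \<Sum>i<n. y \<omega> i ^ e) \<in> borel_measurable M"
  shows "(\<lambda>\<omega>. \<Sum>i<n. if t < y \<omega> i then 1 else 0 :: real) \<in> borel_measurable M"
proof (rule borel_measurable_LIMSEQ_real)
  \<comment> \<open>Ramps that vanish up to \<open>t\<close> and steepen to its right; their limit
    is the indicator of the open half-line above \<open>t\<close>.\<close>
  define g where "g N x = min 1 (max 0 (real N * (x - t)))" for N x
  show "(\<lambda>\<omega>. \<Sum>i<n. g N (y \<omega> i)) \<in> borel_measurable M" for N
  proof (rule measurable_sum_continuous[OF pow])
    show "continuous_on UNIV (g N)" unfolding g_def by (intro continuous_intros)
  qed
  have "(\<lambda>N. g N x) \<longlonglongrightarrow> (if t < x then 1 else 0)" for x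
  proof (cases "t < x")
    case True
    obtain K :: nat where K: "1 / (x - t) < real K" using reals_Archimedean2 by blast
    have "g N x = 1" if "K \<le> N" for N
    proof -
      have "1 / (x - t) \<le> real N" using K that by linarith
      then have "1 \<le> real N * (x - t)" using True by (simp add: field_simps)
      then show ?thesis by (simp add: g_def)
    qed
    then have "\<forall>\<^sub>F N in sequentially. g N x = 1" by (auto simp: eventually_sequentially)
    then show ?thesis using True by (simp add: tendsto_eventually)
  next
    case False
    then have "real N * (x - t) \<le> 0" for N by (intro mult_nonneg_nonpos) auto
    then have "g N x = 0" for N by (simp add: g_def max_absorb1)
    then show ?thesis using False by simp
  qed
  then show "(\<lambda>N. \<Sum>i<n. g N (y \<omega> i)) \<longlonglongrightarrow> (\<Sum>i<n. if t < y \<omega> i then 1 else 0)" for \<omega>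
    by (intro tendsto_sum)
qed

lemma measurable_of_power_sums:
  fixes y :: "'a \<Rightarrow> nat \<Rightarrow> real"
  assumes pow: "\<And>e. (\<lambda>\<omega>. \<Sum>i<n. y \<omega> i ^ e) \<in> borel_measurable M"
    and dec: "\<And>\<omega> i j. i \<le> j \<Longrightarrow> j < n \<Longrightarrow> y \<omega> j \<le> y \<omega> i"
    and i: "i < n"
  shows "(\<lambda>\<omega>. y \<omega> i) \<in> borel_measurable M"
  unfolding borel_measurable_iff_greater
proof
  fix t
  let ?c = "\<lambda>\<omega>. \<Sum>j<n. if t < y \<omega> j then 1 else 0 :: real"
  \<comment> \<open>In decreasing order with indices from 0, entry \<open>i\<close> exceeds
    \<open>t\<close> exactly when at least \<open>i + 1\<close> entries do.\<close>
  have count: "t < y \<omega> i \<longleftrightarrow> real i < ?c \<omega>" for \<omega>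
  proof -
    have c: "?c \<omega> = real (card {j. j < n \<and> t < y \<omega> j})"
      by (simp add: sum.If_cases Int_def lessThan_def)
    show ?thesis
    proof
      assume t: "t < y \<omega> i"
      have "{..i} \<subseteq> {j. j < n \<and> t < y \<omega> j}"
      proof
        fix j assume "j \<in> {..i}"
        then show "j \<in> {j. j < n \<and> t < y \<omega> j}" using dec[of j i \<omega>] i t by force
      qed
      from card_mono[OF _ this] show "real i < ?c \<omega>" unfolding c by simp
    next
      assume less: "real i < ?c \<omega>"
      show "t < y \<omega> i"
      proof (rule ccontr)
        assume t: "\<not> t < y \<omega> i"
        have "{j. j < n \<and> t < y \<omega> j} \<subseteq> {..<i}"
        proof
          fix j assume j: "j \<in> {j. j < n \<and> t < y \<omega> j}"
          then have "\<not> i \<le> j" using dec[of i j \<omega>] t by force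
          then show "j \<in> {..<i}" by simp
        qed
        from card_mono[OF _ this] show False using less unfolding c by simp
      qed
    qed
  qed
  have "?c \<in> borel_measurable M" by (rule measurable_count_greater[OF pow])
  then have "{\<omega> \<in> space M. real i < ?c \<omega>} \<in> sets M"
    unfolding borel_measurable_iff_greater by (rule spec)
  then show "{\<omega> \<in> space M. t < y \<omega> i} \<in> sets M" by (simp only: count)
qed

lemma measurable_t_eigvals:
  assumes sym: "\<And>\<omega>. tsymmetric m p (H \<omega>)"
    and meas: "\<And>i j k. i < m \<Longrightarrow> j < m \<Longrightarrow> k < p \<Longrightarrow> (\<lambda>\<omega>. H \<omega> i j k) \<in> borel_measurable M"
    and i: "i < m * p"
  shows "(\<lambda>\<omega>. t_eigvals m p (H \<omega>) ! i) \<in> borel_measurable M"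
proof (rule measurable_of_power_sums[OF _ _ i])
  show "t_eigvals m p (H \<omega>) ! j \<le> t_eigvals m p (H \<omega>) ! i" if "i \<le> j" "j < m * p" for \<omega> i j
    using that by (intro t_eigvals_decreasing) (simp_all add: length_t_eigvals[OF sym])
  have entry: "(\<lambda>\<omega>. fourier_block m p (ctensor_of (H \<omega>)) k $$ (i, j)) \<in> borel_measurable M"
    if "k < p" "i < m" "j < m" for k i j
    unfolding fourier_block_index[OF that] ctensor_of_def
    using that meas by (intro borel_measurable_sum borel_measurable_times borel_measurable_const
        borel_measurable_of_real) auto
  have "(\<lambda>\<omega>. (fourier_block m p (ctensor_of (H \<omega>)) k ^\<^sub>m e) $$ (i, j)) \<in> borel_measurable M"
    if k: "k < p" and "i < m" "j < m" for k i j e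
    using that(2,3)
  proof (induction e arbitrary: i j)
    case (Suc e)
    have carr: "fourier_block m p (ctensor_of (H \<omega>)) k ^\<^sub>m e \<in> carrier_mat m m" for \<omega>
      by (rule pow_carrier_mat) simp
    show ?case
      unfolding pow_mat.simps mat_mult_index_sum[OF carr fourier_block_carrier Suc.prems]
      using Suc entry[OF k] by (intro borel_measurable_sum borel_measurable_times) auto
  qed simp
  then have total: "(\<lambda>\<omega>. \<Sum>k<p. \<Sum>i<m. (fourier_block m p (ctensor_of (H \<omega>)) k ^\<^sub>m e) $$ (i, i)) \<in> borel_measurable M" for e
    by (intro borel_measurable_sum) auto
  show "(\<lambda>\<omega>. \<Sum>i<m * p. t_eigvals m p (H \<omega>) ! i ^ e) \<in> borel_measurable M" for e
    unfolding sum_t_eigvals_power[OF sym] by (rule measurable_compose[OF total borel_measurable_Re])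
qed

section \<open>The equivalence\<close>

text \<open>A convex \<open>f\<close> need not preserve the order of the eigenvalues, so the list on
  the right is unsorted and agrees with the T-singular values only as a multiset. Nonnegativity of
  \<open>f\<close> removes the absolute values.\<close>

lemma ui_norm_tensor_fun:
  assumes "tsymmetric m p H" "sym_gauge (m * p) \<rho>" "\<And>x. 0 \<le> f x"
  shows "ui_norm m p \<rho> (tensor_fun m p f H) = \<rho> (map (\<lambda>i. f (t_eigvals m p H ! i)) [0..<m * p])"
  unfolding ui_norm_def
proof (rule sym_gauge_mset_cong[OF assms(2)])
  have "map (\<lambda>i. f (t_eigvals m p H ! i)) [0..<m * p] = map f (map (\<lambda>i. t_eigvals m p H ! i) [0..<m * p])"
    by simp
  also have "map (\<lambda>i. t_eigvals m p H ! i) [0..<m * p] = t_eigvals m p H"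
    using map_nth[of "t_eigvals m p H"] by (simp only: length_t_eigvals[OF assms(1)])
  finally show "mset (t_singvals m p (tensor_fun m p f H)) = mset (map (\<lambda>i. f (t_eigvals m p H ! i)) [0..<m * p])"
    unfolding mset_t_singvals_tensor_fun[OF assms(1)] using assms(3) by simp
qed simp

text \<open>The cases \<open>k = 0\<close> and \<open>k = n\<close> are added to the definition: the
  former is trivial, the latter is the equality of totals. Abel summation uses the inequalities in
  this uniform form.\<close>

lemma majorized_decreasing_iff:
  assumes "\<And>i j. i \<le> j \<Longrightarrow> j < n \<Longrightarrow> x j \<le> x i" "\<And>i j. i \<le> j \<Longrightarrow> j < n \<Longrightarrow> z j \<le> z i"
  shows "majorized (map x [0..<n]) (map z [0..<n]) \<longleftrightarrow>
    (\<forall>k\<le>n. (\<Sum>i<k. x i) \<le> (\<Sum>i<k. z i)) \<and> (\<Sum>i<n. x i) = (\<Sum>i<n. z i)"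
proof -
  have rev_sort: "rev (sort (map v [0..<n])) = map v [0..<n]"
    if "\<And>i j. i \<le> j \<Longrightarrow> j < n \<Longrightarrow> v j \<le> v i" for v :: "nat \<Rightarrow> real"
  proof -
    have "sorted (rev (map v [0..<n]))"
      unfolding sorted_rev_iff_nth_mono using that by simp
    then have "sort (map v [0..<n]) = rev (map v [0..<n])"
      by (intro properties_for_sort) auto
    then show ?thesis by simp
  qed
  have sums: "(\<Sum>i<k. map v [0..<n] ! i) = (\<Sum>i<k. v i)" if "k \<le> n" for v :: "nat \<Rightarrow> real" and k
    using that by (intro sum.cong) auto
  have sort_xz: "rev (sort (map x [0..<n])) = map x [0..<n]" "rev (sort (map z [0..<n])) = map z [0..<n]"
    using assms by (auto intro!: rev_sort)
  have "majorized (map x [0..<n]) (map z [0..<n]) \<longleftrightarrow>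
    (\<forall>k\<in>{1..<n}. (\<Sum>i<k. x i) \<le> (\<Sum>i<k. z i)) \<and> (\<Sum>i<n. x i) = (\<Sum>i<n. z i)"
    unfolding majorized_def sort_xz Let_def length_map length_upt
    using sums by auto
  also have "\<dots> \<longleftrightarrow> (\<forall>k\<le>n. (\<Sum>i<k. x i) \<le> (\<Sum>i<k. z i)) \<and> (\<Sum>i<n. x i) = (\<Sum>i<n. z i)"
  proof
    assume le: "(\<forall>k\<in>{1..<n}. (\<Sum>i<k. x i) \<le> (\<Sum>i<k. z i)) \<and> (\<Sum>i<n. x i) = (\<Sum>i<n. z i)"
    have "(\<Sum>i<k. x i) \<le> (\<Sum>i<k. z i)" if "k \<le> n" for k
    proof -
      from that consider "k = 0" | "k = n" | "k \<in> {1..<n}" by fastforce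
      then show ?thesis using le by cases auto
    qed
    with le show "(\<forall>k\<le>n. (\<Sum>i<k. x i) \<le> (\<Sum>i<k. z i)) \<and> (\<Sum>i<n. x i) = (\<Sum>i<n. z i)" by blast
  qed auto
  finally show ?thesis .
qed

lemma ky_fan_full: "ky_fan n n x = (\<Sum>i<n. \<bar>x ! i\<bar>)"
proof (rule antisym)
  show "ky_fan n n x \<le> (\<Sum>i<n. \<bar>x ! i\<bar>)"
    unfolding ky_fan_le_iff[OF order_refl]
  proof (intro allI impI)
    fix S assume "S \<subseteq> {..<n}" "card S = n"
    then have "S = {..<n}" using card_subset_eq[of "{..<n}" S] by simp
    then show "(\<Sum>i\<in>S. \<bar>x ! i\<bar>) \<le> (\<Sum>i<n. \<bar>x ! i\<bar>)" by simp
  qed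
  show "(\<Sum>i<n. \<bar>x ! i\<bar>) \<le> ky_fan n n x" by (rule ky_fan_upper) simp_all
qed

text \<open>The test functions of (ii) to (i). The cut-off ensures nonnegativity on the whole line
  and has no effect where the affine part is nonnegative.\<close>

lemma convex_on_max_0_affine: "convex_on UNIV (\<lambda>x::real. max 0 (a * x + b))"
proof (rule convex_onI)
  fix t x y :: real assume t: "0 < t" "t < 1"
  have "a * ((1 - t) *\<^sub>R x + t *\<^sub>R y) + b = (1 - t) * (a * x + b) + t * (a * y + b)"
    by (simp add: algebra_simps)
  also have "\<dots> \<le> (1 - t) * max 0 (a * x + b) + t * max 0 (a * y + b)"
    using t by (intro add_mono mult_left_mono) auto
  finally have "a * ((1 - t) *\<^sub>R x + t *\<^sub>R y) + b
      \<le> (1 - t) * max 0 (a * x + b) + t * max 0 (a * y + b)" .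
  moreover have "0 \<le> (1 - t) * max 0 (a * x + b) + t * max 0 (a * y + b)"
    using t by (intro add_nonneg_nonneg mult_nonneg_nonneg) auto
  ultimately show "max 0 (a * ((1 - t) *\<^sub>R x + t *\<^sub>R y) + b)
      \<le> (1 - t) * max 0 (a * x + b) + t * max 0 (a * y + b)"
    by (rule max.boundedI[rotated])
qed simp

theorem mainTheorem5:
  fixes m p :: nat
    and \<nu> :: "'a::metric_space measure"
    and C :: rtensor
    and D :: "'a \<Rightarrow> rtensor"
  assumes m_pos: "0 < m" and p_pos: "0 < p"
    and sigma_compact: "\<exists>K::nat \<Rightarrow> 'a set. (\<forall>n. compact (K n)) \<and> (\<Union>n. K n) = UNIV"
    and prob: "prob_space \<nu>"
    and borel: "sets \<nu> = sets borel"
    and C_sym: "tsymmetric m p C"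
    and D_sym: "\<And>\<tau>. tsymmetric m p (D \<tau>)"
    and D_cont: "\<And>i j k. i < m \<Longrightarrow> j < m \<Longrightarrow> k < p \<Longrightarrow> continuous_on UNIV (\<lambda>\<tau>. D \<tau> i j k)"
    and D_bdd: "bdd_above (range (\<lambda>\<tau>. t_opnorm m p (D \<tau>)))"
  shows "majorized (t_eigvals m p C)
            (map (\<lambda>i. \<integral>\<tau>. (t_eigvals m p (D \<tau>) ! i) \<partial>\<nu>) [0..<m*p])
         \<longleftrightarrow>
         (\<forall>f::real \<Rightarrow> real. convex_on UNIV f \<longrightarrow> (\<forall>x. 0 \<le> f x) \<longrightarrow>
            (\<forall>\<rho>. sym_gauge (m*p) \<rho> \<longrightarrow>
               ennreal (ui_norm m p \<rho> (tensor_fun m p f C))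
                 \<le> (\<integral>\<^sup>+\<tau>. ennreal (ui_norm m p \<rho> (tensor_fun m p f (D \<tau>))) \<partial>\<nu>)))"
proof -
  interpret prob_space \<nu> by (rule prob)
  let ?n = "m * p"
  define x where "x i = t_eigvals m p C ! i" for i
  define y where "y \<tau> i = t_eigvals m p (D \<tau>) ! i" for \<tau> i
  define z where "z i = (\<integral>\<tau>. y \<tau> i \<partial>\<nu>)" for i
  have n: "0 < ?n" using m_pos p_pos by simp
  obtain b where b: "t_opnorm m p (D \<tau>) \<le> b" for \<tau> using D_bdd unfolding bdd_above_def by auto
  \<comment> \<open>\<open>B\<close> dominates the eigenvalues of \<open>C\<close> as well as those
    of every \<open>D \<tau>\<close>, so adding it to plus or minus any of them gives a nonnegative
    number.\<close>
  define B where "B = max b (t_opnorm m p C)"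
  have y_bound: "\<bar>y \<tau> i\<bar> \<le> B" if "i < ?n" for \<tau> i
    using abs_t_eigvals_le_t_opnorm[OF D_sym that, of \<tau>] b[of \<tau>] by (simp add: y_def B_def)
  have x_bound: "\<bar>x i\<bar> \<le> B" if "i < ?n" for i
    using abs_t_eigvals_le_t_opnorm[OF C_sym that] by (simp add: x_def B_def)
  have x_dec: "x j \<le> x i" if "i \<le> j" "j < ?n" for i j
    unfolding x_def using that by (intro t_eigvals_decreasing) (simp_all add: length_t_eigvals[OF C_sym])
  have y_dec: "y \<tau> j \<le> y \<tau> i" if "i \<le> j" "j < ?n" for \<tau> i j
    unfolding y_def using that by (intro t_eigvals_decreasing) (simp_all add: length_t_eigvals[OF D_sym])
  have "(\<lambda>\<tau>. D \<tau> i j k) \<in> borel_measurable \<nu>" if "i < m" "j < m" "k < p" for i j k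
    using borel_measurable_continuous_onI[OF D_cont[OF that]] measurable_cong_sets[OF borel refl] by blast
  then have y_meas: "(\<lambda>\<tau>. y \<tau> i) \<in> borel_measurable \<nu>" if "i < ?n" for i
    unfolding y_def using D_sym that by (intro measurable_t_eigvals) auto
  have y_int: "integrable \<nu> (\<lambda>\<tau>. y \<tau> i)" if "i < ?n" for i
    using y_bound[OF that] y_meas[OF that] by (intro integrable_const_bound[where B = B]) auto
  have z_dec: "z j \<le> z i" if "i \<le> j" "j < ?n" for i j
    unfolding z_def using y_int y_dec that by (intro integral_mono) auto
  have "t_eigvals m p C = map x [0..<?n]"
    using map_nth[of "t_eigvals m p C"] unfolding length_t_eigvals[OF C_sym] x_def by simp
  moreover have "map (\<lambda>i. \<integral>\<tau>. (t_eigvals m p (D \<tau>) ! i) \<partial>\<nu>) [0..<?n] = map z [0..<?n]"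
    by (simp add: z_def y_def)
  ultimately have major: "majorized (t_eigvals m p C) (map (\<lambda>i. \<integral>\<tau>. (t_eigvals m p (D \<tau>) ! i) \<partial>\<nu>) [0..<?n])
      \<longleftrightarrow> (\<forall>k\<le>?n. (\<Sum>i<k. x i) \<le> (\<Sum>i<k. z i)) \<and> (\<Sum>i<?n. x i) = (\<Sum>i<?n. z i)"
    using majorized_decreasing_iff[of ?n x z] x_dec z_dec by (simp only:)
  have norm_C: "ui_norm m p \<rho> (tensor_fun m p f C) = \<rho> (map (\<lambda>i. f (x i)) [0..<?n])"
    and norm_D: "ui_norm m p \<rho> (tensor_fun m p f (D \<tau>)) = \<rho> (map (\<lambda>i. f (y \<tau> i)) [0..<?n])"
    if "sym_gauge ?n \<rho>" "\<And>x. 0 \<le> f x" for \<rho> f \<tau>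
    unfolding x_def y_def by (rule ui_norm_tensor_fun[OF C_sym that], rule ui_norm_tensor_fun[OF D_sym that])
  show ?thesis
    unfolding major
  proof (intro iffI allI impI conjI)
    fix f :: "real \<Rightarrow> real" and \<rho>
    assume le: "(\<forall>k\<le>?n. (\<Sum>i<k. x i) \<le> (\<Sum>i<k. z i)) \<and> (\<Sum>i<?n. x i) = (\<Sum>i<?n. z i)"
      and f: "convex_on UNIV f" "\<forall>x. 0 \<le> f x" and \<rho>: "sym_gauge ?n \<rho>"
    have f0: "0 \<le> f t" for t using f(2) by blast
    show "ennreal (ui_norm m p \<rho> (tensor_fun m p f C))
        \<le> (\<integral>\<^sup>+\<tau>. ennreal (ui_norm m p \<rho> (tensor_fun m p f (D \<tau>))) \<partial>\<nu>)"
      unfolding norm_C[OF \<rho> f0] norm_D[OF \<rho> f0]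
    proof (rule sym_gauge_convex_le_nn_integral[OF \<rho> f(1) f0])
      show "(\<Sum>i<k. x i) \<le> (\<Sum>i<k. \<integral>\<tau>. y \<tau> i \<partial>\<nu>)" if "k \<le> ?n" for k
        using le that unfolding z_def by blast
      show "(\<Sum>i<?n. x i) = (\<Sum>i<?n. \<integral>\<tau>. y \<tau> i \<partial>\<nu>)" using le unfolding z_def by blast
    qed (fact x_dec y_int)+
  next
    assume ineq: "\<forall>f::real \<Rightarrow> real. convex_on UNIV f \<longrightarrow> (\<forall>x. 0 \<le> f x) \<longrightarrow>
        (\<forall>\<rho>. sym_gauge ?n \<rho> \<longrightarrow> ennreal (ui_norm m p \<rho> (tensor_fun m p f C))
            \<le> (\<integral>\<^sup>+\<tau>. ennreal (ui_norm m p \<rho> (tensor_fun m p f (D \<tau>))) \<partial>\<nu>))"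
    \<comment> \<open>On \<open>[-B, B]\<close> the function is affine, so its Ky Fan norms are affine in the partial sums.\<close>
    have affine: "(\<Sum>i<k. a * x i + B) \<le> (\<Sum>i<k. a * z i + B)"
      if k: "0 < k" "k \<le> ?n" and a: "a = 1 \<or> a = - 1 \<and> k = ?n" for k and a :: real
    proof -
      define f where "f t = max 0 (a * t + B)" for t
      have f: "convex_on UNIV f" unfolding f_def by (rule convex_on_max_0_affine)
      have f0: "0 \<le> f t" for t by (simp add: f_def)
      have gauge: "sym_gauge ?n (ky_fan ?n k)" by (rule sym_gauge_ky_fan[OF k])
      have eval: "ky_fan ?n k (map (\<lambda>i. f (v i)) [0..<?n]) = (\<Sum>i<k. a * v i + B)"
        if v: "\<And>i. i < ?n \<Longrightarrow> \<bar>v i\<bar> \<le> B" and v_dec: "\<And>i j. i \<le> j \<Longrightarrow> j < ?n \<Longrightarrow> v j \<le> v i" for v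
      proof -
        have fv: "f (v i) = a * v i + B" "0 \<le> a * v i + B" if "i < ?n" for i
          using v[OF that] a by (auto simp: f_def)
        have "ky_fan ?n k (map (\<lambda>i. f (v i)) [0..<?n]) = (\<Sum>i<k. f (v i))"
          using a
        proof
          assume "a = 1"
          then show ?thesis
            using fv v_dec by (intro ky_fan_decreasing[OF k(2)]) simp_all
        next
          \<comment> \<open>Here \<open>f\<close> reverses the order, so the first \<open>k\<close>
            entries are no longer the largest; the full sum with \<open>k = ?n\<close> does not
            depend on the order.\<close>
          assume "a = - 1 \<and> k = ?n"
          then show ?thesis by (simp add: ky_fan_full f0)
        qed
        also have "\<dots> = (\<Sum>i<k. a * v i + B)" using k fv by (intro sum.cong) auto
        finally show ?thesis .
      qed
      have int: "integrable \<nu> (\<lambda>\<tau>. \<Sum>i<k. a * y \<tau> i + B)"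
        using y_int k by (intro Bochner_Integration.integrable_sum Bochner_Integration.integrable_add
            integrable_mult_right integrable_const) auto
      have nonneg: "0 \<le> a * v + B" if "\<bar>v\<bar> \<le> B" for v
        using that a by auto
      have eval_x: "ky_fan ?n k (map (\<lambda>i. f (x i)) [0..<?n]) = (\<Sum>i<k. a * x i + B)"
        by (rule eval) (rule x_bound x_dec; assumption)+
      have eval_y: "ky_fan ?n k (map (\<lambda>i. f (y \<tau> i)) [0..<?n]) = (\<Sum>i<k. a * y \<tau> i + B)" for \<tau>
        by (rule eval) (rule y_bound y_dec; assumption)+
      have "\<forall>x. 0 \<le> f x" using f0 by blast
      from ineq[THEN spec, THEN mp, OF f, THEN mp, OF this, THEN spec, THEN mp, OF gauge]
      have "ennreal (\<Sum>i<k. a * x i + B) \<le> (\<integral>\<^sup>+\<tau>. ennreal (\<Sum>i<k. a * y \<tau> i + B) \<partial>\<nu>)"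
        unfolding norm_C[OF gauge f0] norm_D[OF gauge f0] eval_x eval_y .
      also have "\<dots> = ennreal (\<integral>\<tau>. (\<Sum>i<k. a * y \<tau> i + B) \<partial>\<nu>)"
        using k y_bound by (intro nn_integral_eq_integral[OF int] AE_I2 sum_nonneg nonneg) auto
      also have "(\<integral>\<tau>. (\<Sum>i<k. a * y \<tau> i + B) \<partial>\<nu>) = (\<Sum>i<k. \<integral>\<tau>. a * y \<tau> i + B \<partial>\<nu>)"
        using y_int k by (intro Bochner_Integration.integral_sum Bochner_Integration.integrable_add
            integrable_mult_right integrable_const) auto
      also have "\<dots> = (\<Sum>i<k. a * z i + B)"
      proof (intro sum.cong refl)
        fix i assume "i \<in> {..<k}"
        then have "integrable \<nu> (\<lambda>\<tau>. y \<tau> i)" using y_int k by simp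
        then show "(\<integral>\<tau>. a * y \<tau> i + B \<partial>\<nu>) = a * z i + B" by (simp add: z_def prob_space)
      qed
      finally have le: "ennreal (\<Sum>i<k. a * x i + B) \<le> ennreal (\<Sum>i<k. a * z i + B)" .
      \<comment> \<open>An inequality between \<open>ennreal\<close> values can be taken back to the
        reals once the right-hand sum is known to be nonnegative.\<close>
      have "\<bar>z i\<bar> \<le> B" if "i < ?n" for i
      proof -
        have "\<bar>z i\<bar> \<le> (\<integral>\<tau>. \<bar>y \<tau> i\<bar> \<partial>\<nu>)" unfolding z_def by (rule integral_abs_bound)
        also have "\<dots> \<le> (\<integral>\<tau>. B \<partial>\<nu>)"
          using y_int[OF that] y_bound[OF that] by (intro integral_mono) auto
        finally show ?thesis by (simp add: prob_space)
      qed
      then have "0 \<le> (\<Sum>i<k. a * z i + B)" using k by (intro sum_nonneg nonneg) auto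
      then show ?thesis using le by simp
    qed
    show le: "(\<Sum>i<k. x i) \<le> (\<Sum>i<k. z i)" if "k \<le> ?n" for k
    proof (cases "k = 0")
      case False
      then show ?thesis using affine[of k 1] that by (simp add: sum.distrib)
    qed simp
    \<comment> \<open>The case \<open>a = - 1\<close> gives the reverse of the last partial-sum
      inequality, the constant contributions of \<open>B\<close> cancelling on both sides.\<close>
    show "(\<Sum>i<?n. x i) = (\<Sum>i<?n. z i)"
      using le[of ?n] affine[OF n order_refl, of "- 1"] by (simp add: sum_subtractf)
  qed
qed

end
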